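(* Let $a>0$, let $q\in L^2(0,a)$ be complex-valued, and let $\alpha_0\ge 0$, $\alpha>0$, $\beta_0,\beta\in\mathbb{C}$. (1) At most finitely many eigenvalues of $L(q,\alpha_0,\beta_0,\alpha,\beta)$ lie in the closed lower half-plane. If $(\alpha_0-1)(1-\alpha)\ne0$ and $(\alpha_0+1)|\alpha-1|>(\alpha+1)|\alpha_0-1|$ (respectively $(\alpha_0+1)|\alpha-1|<(\alpha+1)|\alpha_0-1|$), then at most finitely many eigenvalues of $L(q,\alpha_0,\beta_0,-\alpha,\beta)$ lie in the closed lower (respectively upper) half-plane. (2) Suppose in addition that $q$ is real-valued and $\beta,\beta_0\in\mathbb{R}$. Then: (i) If $0$ is an eigenvalue of $L(q,\alpha_0,\beta_0,\alpha,\beta)$, then it is simple. (ii) If $\lambda$ is an eigenvalue of $L(q,\alpha_0,\beta_0,\pm\alpha,\beta)$, then $-\overline{\lambda}$ is also an eigenvalue of the same problem. (iii) All nonzero eigenvalues of $L(q,\alpha_0,\beta_0,\alpha,\beta)$ in the lower half-plane lie on the negative imaginary semiaxis $i\mathbb{R}_-$ and are simple. (iv) Assume that there are $\kappa$ eigenvalues of $L(q,\alpha_0,\beta_0,\alpha,\beta)$ on $i\mathbb{R}_-$, denoted by $\lambda_{-j}=-i|\lambda_{-j}|$, $j=1,\dots,\kappa$, with $|\lambda_{-j}|<|\lambda_{-(j+1)}|$. Then $$i\dot\Delta_+(-i|\lambda_{-j}|)(-1)^{\kappa-j}<0,\qquad \Delta_0(-i|\lambda_{-j}|)(-1)^{\kappa-j}>0,\qquad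 j=1,\dots,\kappa,$$ where $\dot\Delta_+(\lambda)=\frac{d\Delta_+(\lambda)}{d\lambda}$. Moreover, the zeros of $\Delta_0(\lambda)$ and $\Delta_+(\lambda)$ on $i\mathbb{R}_-$ interlace each other.
   Context: $L(q,\alpha_0,\beta_0,\alpha,\beta)$ denotes the boundary value problem $$-y''+q(x)y=\lambda^2y,\ x\in(0,a),\qquad y'(0)-(i\alpha_0\lambda+\beta_0)y(0)=0,\qquad y'(a)+(i\alpha\lambda+\beta)y(a)=0,$$ with spectral parameter $\lambda\in\mathbb{C}$; $L(q,\alpha_0,\beta_0,-\alpha,\beta)$ is the same problem with $\alpha$ replaced by $-\alpha$ in the condition at $a$. Let $y(\lambda,x)$ be the solution of $-y''+qy=\lambda^2y$ with $y(\lambda,0)=1$, $y'(\lambda,0)=i\alpha_0\lambda+\beta_0$ (prime is $d/dx$). Put $\Delta_\pm(\lambda)=y'(\lambda,a)+(\pm i\alpha\lambda+\beta)y(\lambda,a)$ and $\Delta_0(\lambda)=y(\lambda,a)$; these are entire functions of $\lambda$. The eigenvalues of $L(q,\alpha_0,\beta_0,\pm\alpha,\beta)$ are the zeros of $\Delta_\pm$, respectively; the multiplicity of an eigenvalue is its multiplicity as a zero, and it is simple if this multiplicity is one. *)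

theory Defs
  imports "HOL-Complex_Analysis.Complex_Analysis" "HOL-Library.Complex_Order"
begin

definition square_integrable :: "real \<Rightarrow> (real \<Rightarrow> complex) \<Rightarrow> bool" where
  "square_integrable a q \<longleftrightarrow>
     set_borel_measurable lebesgue {0<..<a} q \<and>
     set_integrable lebesgue {0<..<a} (\<lambda>x. (cmod (q x))\<^sup>2)"

text \<open>
  Solutions of \<open>- y'' + q y = z\<^sup>2 y\<close> on \<open>(0, a)\<close> are understood in the usual (Caratheodory) sense:
  \<open>y\<close> is differentiable on \<open>[0, a]\<close>, its derivative \<open>y1\<close> is absolutely continuous, and the equation
  holds almost everywhere. Absolute continuity of \<open>y1\<close> is expressed by writing it as the
  indefinite Lebesgue integral of an integrable function \<open>y2\<close>, which then is the a.e. second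
  derivative of \<open>y\<close>.
\<close>
definition sl_solution :: "real \<Rightarrow> (real \<Rightarrow> complex) \<Rightarrow> complex \<Rightarrow> (real \<Rightarrow> complex) \<Rightarrow> bool" where
  "sl_solution a q z y \<longleftrightarrow>
     (\<exists>y1 y2.
        (\<forall>x\<in>{0..a}. (y has_vector_derivative y1 x) (at x within {0..a})) \<and>
        set_integrable lebesgue {0..a} y2 \<and>
        (\<forall>x\<in>{0..a}. y1 x = y1 0 + (LINT t:{0..x}|lebesgue. y2 t)) \<and>
        (AE x in lebesgue. x \<in> {0<..<a} \<longrightarrow> - y2 x + q x * y x = z\<^sup>2 * y x))"

definition deriv_on :: "real \<Rightarrow> (real \<Rightarrow> complex) \<Rightarrow> real \<Rightarrow> complex" where
  "deriv_on a y x = vector_derivative y (at x within {0..a})"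

text \<open>
  For square integrable \<open>q\<close> and \<open>a > 0\<close> the initial value problem determines \<open>y\<close> uniquely on
  \<open>[0, a]\<close>, and only the restriction to this interval is used below; the choice operator merely
  fixes the irrelevant values outside of it.
\<close>
definition sl_sol :: "real \<Rightarrow> (real \<Rightarrow> complex) \<Rightarrow> real \<Rightarrow> complex \<Rightarrow> complex \<Rightarrow> real \<Rightarrow> complex" where
  "sl_sol a q \<alpha>\<^sub>0 \<beta>\<^sub>0 z =
     (SOME y. sl_solution a q z y \<and> y 0 = 1 \<and>
              deriv_on a y 0 = \<i> * of_real \<alpha>\<^sub>0 * z + \<beta>\<^sub>0)"

definition Delta0 :: "real \<Rightarrow> (real \<Rightarrow> complex) \<Rightarrow> real \<Rightarrow> complex \<Rightarrow> complex \<Rightarrow> complex" where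
  "Delta0 a q \<alpha>\<^sub>0 \<beta>\<^sub>0 z = sl_sol a q \<alpha>\<^sub>0 \<beta>\<^sub>0 z a"

text \<open>
  The characteristic function of \<open>L(q, \<alpha>\<^sub>0, \<beta>\<^sub>0, \<alpha>, \<beta>)\<close> for a real \<open>\<alpha>\<close> of either sign: for
  \<open>\<alpha> > 0\<close>, \<open>\<Delta>\<^sub>+\<close> is obtained with the argument \<open>\<alpha>\<close> and \<open>\<Delta>\<^sub>-\<close> with the argument \<open>- \<alpha>\<close>.
\<close>
definition Delta ::
  "real \<Rightarrow> (real \<Rightarrow> complex) \<Rightarrow> real \<Rightarrow> complex \<Rightarrow> real \<Rightarrow> complex \<Rightarrow> complex \<Rightarrow> complex" where
  "Delta a q \<alpha>\<^sub>0 \<beta>\<^sub>0 \<alpha> \<beta> z =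
     deriv_on a (sl_sol a q \<alpha>\<^sub>0 \<beta>\<^sub>0 z) a
       + (\<i> * of_real \<alpha> * z + \<beta>) * sl_sol a q \<alpha>\<^sub>0 \<beta>\<^sub>0 z a"

definition eigenvalue ::
  "real \<Rightarrow> (real \<Rightarrow> complex) \<Rightarrow> real \<Rightarrow> complex \<Rightarrow> real \<Rightarrow> complex \<Rightarrow> complex \<Rightarrow> bool" where
  "eigenvalue a q \<alpha>\<^sub>0 \<beta>\<^sub>0 \<alpha> \<beta> z \<longleftrightarrow> Delta a q \<alpha>\<^sub>0 \<beta>\<^sub>0 \<alpha> \<beta> z = 0"

definition simple_eigenvalue ::
  "real \<Rightarrow> (real \<Rightarrow> complex) \<Rightarrow> real \<Rightarrow> complex \<Rightarrow> real \<Rightarrow> complex \<Rightarrow> complex \<Rightarrow> bool" where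
  "simple_eigenvalue a q \<alpha>\<^sub>0 \<beta>\<^sub>0 \<alpha> \<beta> z \<longleftrightarrow>
     eigenvalue a q \<alpha>\<^sub>0 \<beta>\<^sub>0 \<alpha> \<beta> z \<and> zorder (Delta a q \<alpha>\<^sub>0 \<beta>\<^sub>0 \<alpha> \<beta>) z = 1"

definition neg_imag_axis :: "complex set" where
  "neg_imag_axis = {z. Re z = 0 \<and> Im z < 0}"

text \<open>
  Strict interlacing. The last two conjuncts force exactly one element of one set to lie between
  consecutive elements of the other: two such elements would again be separated.
\<close>
definition interlace :: "real set \<Rightarrow> real set \<Rightarrow> bool" where
  "interlace S T \<longleftrightarrow>
     S \<inter> T = {} \<and>
     (\<forall>s\<in>S. \<forall>s'\<in>S. s < s' \<longrightarrow> (\<exists>t\<in>T. s < t \<and> t < s')) \<and>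
     (\<forall>t\<in>T. \<forall>t'\<in>T. t < t' \<longrightarrow> (\<exists>s\<in>S. t < s \<and> s < t'))"

end

theory Submission
  imports Defs
begin

text \<open>
  Everything is read off from the solution \<open>Y z\<close> of the initial value problem and from Green's
  identity for two functions whose second derivatives are merely integrable.

  The delicate point for a merely integrable \<open>q\<close> is Green's identity. It follows from
  integration by parts for a continuously differentiable factor and an absolutely continuous one
  (\<open>integral_product_rule\<close>), and this needs no differentiation almost everywhere: the difference of
  the two sides has increments bounded by the length of the interval times a quantity that tends to
  zero, so it is constant. The solution theory (\<open>volterra_exists\<close>, \<open>volterra_bound\<close>) rests on
  an exponentially weighted supremum norm in which the Picard map is a contraction. The bound also
  yields differentiability in the spectral parameter, because the second-order remainder of the
  solution solves the same equation with a forcing term of quadratic size. Hence the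
  characteristic functions are entire.

  For the finiteness claims, the variation of constants formula shows that
  \<open>\<Delta>\<^sub>\<plusminus>\<close> differs by \<open>O(exp (\<bar>Im z\<bar> a))\<close> from
  \<open>(i z / 2) (A exp (i z a) - B exp (- i z a))\<close>, where \<open>A = (1 + \<alpha>) (1 + \<alpha>\<^sub>0)\<close> and
  \<open>B = (1 - \<alpha>) (1 - \<alpha>\<^sub>0)\<close>, with \<open>- \<alpha>\<close> in place of \<open>\<alpha>\<close> for \<open>\<Delta>\<^sub>-\<close>. In the lower half-plane the
  first exponential is the large one, in the upper half-plane the second one is. So there are no
  large zeros in the half-plane that belongs to the larger of \<open>\<bar>A\<bar>\<close> and \<open>\<bar>B\<bar>\<close>.

  For real coefficients, conjugation maps the solution for \<open>z\<close> to the one for \<open>- cnj z\<close>, which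
  gives the symmetry of the spectrum. Green's identity for these two solutions gives
  \<open>2 Im z \<integral>\<bar>Y\<bar>\<^sup>2 = \<alpha> \<bar>Y(a)\<bar>\<^sup>2 + \<alpha>\<^sub>0\<close> at an eigenvalue with \<open>Re z \<noteq> 0\<close>, which for
  \<open>Im z \<le> 0\<close> forces \<open>Y(a) = Y'(a) = 0\<close>, a contradiction. On the negative imaginary axis
  \<open>z = - i \<tau>\<close> both \<open>\<Delta>\<^sub>0\<close> and \<open>\<Delta>\<^sub>+\<close> are real, and Green's identity for the solution and its
  derivative in \<open>z\<close> gives, with primes denoting derivatives in \<open>\<tau>\<close>,
  \<open>\<Delta>\<^sub>0 \<Delta>\<^sub>+' - \<Delta>\<^sub>0' \<Delta>\<^sub>+ = \<alpha>\<^sub>0 + 2 \<tau> \<integral>Y\<^sup>2 + \<alpha> \<Delta>\<^sub>0\<^sup>2\<close>. The right-hand side is positive for \<open>\<tau> > 0\<close>,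
  and also for \<open>\<tau> = 0\<close> if \<open>0\<close> is an eigenvalue (\<open>axis_wronskian_pos\<close>). This one inequality makes
  the zeros simple and lets them interlace, and it ties the sign of \<open>\<Delta>\<^sub>0\<close> to that of \<open>\<Delta>\<^sub>+'\<close> at the
  eigenvalues. The signs of \<open>\<Delta>\<^sub>+'\<close> alternate along the simple zeros, and the last one is positive
  because \<open>\<Delta>\<^sub>+\<close> is positive for large \<open>\<tau>\<close>.
\<close>

section \<open>Integration by parts with an absolutely continuous factor\<close>

lemma absolutely_integrable_continuous_mult:
  fixes u f :: "real \<Rightarrow> complex"
  assumes "continuous_on {a..b} u" "f absolutely_integrable_on {a..b}"
  shows "(\<lambda>t. u t * f t) absolutely_integrable_on {a..b}"
proof -
  have "bilinear ((*) :: complex \<Rightarrow> complex \<Rightarrow> complex)"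
    by (simp add: bilinear_conv_bounded_bilinear bounded_bilinear_mult)
  moreover have "u \<in> borel_measurable (lebesgue_on {a..b})"
    using assms(1) by (simp add: continuous_imp_measurable_on_sets_lebesgue)
  moreover have "bounded (u ` {a..b})"
    using assms(1) by (simp add: compact_continuous_image compact_imp_bounded)
  ultimately show ?thesis
    using absolutely_integrable_bounded_measurable_product[of "(*)" u "{a..b}" f] assms(2) by simp
qed

lemma absolutely_integrable_cmod:
  fixes f :: "real \<Rightarrow> complex"
  assumes "f absolutely_integrable_on {a..b}"
  shows "(\<lambda>t. cmod (f t)) integrable_on {a..b}"
  using assms by (simp add: absolutely_integrable_on_def)

lemma norm_integral_le_mult:
  fixes f h :: "real \<Rightarrow> complex"
  assumes h: "h integrable_on {s..t}" and f: "f absolutely_integrable_on {s..t}"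
    and le: "\<And>r. r \<in> {s..t} \<Longrightarrow> cmod (h r) \<le> C * cmod (f r)"
  shows "cmod (integral {s..t} h) \<le> C * integral {s..t} (\<lambda>r. cmod (f r))"
proof -
  have "cmod (integral {s..t} h) \<le> integral {s..t} (\<lambda>r. C * cmod (f r))"
    by (rule integral_norm_bound_integral[OF h _ le])
       (auto intro!: integrable_on_mult_right absolutely_integrable_cmod f)
  then show ?thesis by simp
qed

lemma integral_diff_indefinite:
  fixes f :: "real \<Rightarrow> 'b::banach"
  assumes "f integrable_on {0..a}" "0 \<le> s" "s \<le> t" "t \<le> a"
  shows "integral {0..t} f - integral {0..s} f = integral {s..t} f"
proof -
  have "f integrable_on {0..t}"
    by (rule integrable_on_subinterval[OF assms(1)]) (use assms in auto)
  from Henstock_Kurzweil_Integration.integral_combine[OF assms(2,3) this]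
  show ?thesis by (simp add: algebra_simps)
qed

text \<open>
  Replaces the theorem that an absolutely continuous function with zero derivative almost everywhere
  is constant: dividing the bound by \<open>t - s\<close> leaves an increment of the continuous function \<open>G\<close>,
  so the derivative vanishes at every point, without exceptional set.
\<close>
lemma has_vector_derivative_zero_if_increment_bound:
  fixes F :: "real \<Rightarrow> 'b::real_normed_vector" and G :: "real \<Rightarrow> real"
  assumes G: "continuous_on {0..a} G"
    and bound: "\<And>s t. 0 \<le> s \<Longrightarrow> s \<le> t \<Longrightarrow> t \<le> a \<Longrightarrow> norm (F t - F s) \<le> (t - s) * \<bar>G t - G s\<bar>"
    and x: "x \<in> {0..a}"
  shows "(F has_vector_derivative 0) (at x within {0..a})"
proof -
  have G': "((\<lambda>y. \<bar>G y - G x\<bar>) \<longlongrightarrow> 0) (at x within {0..a})"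
    using G x by (auto simp: continuous_on LIM_zero tendsto_rabs_zero)
  have "((\<lambda>y. (1 / norm (y - x)) *\<^sub>R (F y - (F x + (y - x) *\<^sub>R 0))) \<longlongrightarrow> 0) (at x within {0..a})"
  proof (rule Lim_null_comparison[OF _ G'])
    show "\<forall>\<^sub>F y in at x within {0..a}.
            norm ((1 / norm (y - x)) *\<^sub>R (F y - (F x + (y - x) *\<^sub>R 0))) \<le> \<bar>G y - G x\<bar>"
      unfolding eventually_at_filter
    proof (rule always_eventually, intro allI impI)
      fix y assume y: "y \<noteq> x" "y \<in> {0..a}"
      have "norm (F y - F x) \<le> \<bar>y - x\<bar> * \<bar>G y - G x\<bar>"
        using bound[of x y] bound[of y x] x y
        by (cases "x \<le> y") (auto simp: norm_minus_commute abs_minus_commute)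
      then show "norm ((1 / norm (y - x)) *\<^sub>R (F y - (F x + (y - x) *\<^sub>R 0))) \<le> \<bar>G y - G x\<bar>"
        using y by (simp add: divide_simps mult.commute flip: scaleR_diff_right)
    qed
  qed
  then show ?thesis
    unfolding has_vector_derivative_def has_derivative_within
    by (auto intro: bounded_linear_scaleR_left)
qed

text \<open>
  Integration by parts when only one factor is differentiable everywhere. The increment of the
  difference \<open>F\<close> of the two sides over \<open>[s, t]\<close> is
  \<open>\<integral> u'(r) (Z s - Z r) dr + \<integral> (u t - u r) f(r) dr\<close>. With \<open>\<bar>u'\<bar> \<le> L\<close>, each summand is at most
  \<open>L (t - s) \<integral>\<bar>f\<bar>\<close> over \<open>[s, t]\<close>, so \<open>F\<close> has derivative zero.
\<close>
lemma integral_product_rule: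
  fixes u u' f Z :: "real \<Rightarrow> complex"
  assumes a: "0 \<le> a"
    and u: "\<And>x. x \<in> {0..a} \<Longrightarrow> (u has_vector_derivative u' x) (at x within {0..a})"
    and u': "continuous_on {0..a} u'"
    and f: "f absolutely_integrable_on {0..a}"
    and Z: "\<And>x. x \<in> {0..a} \<Longrightarrow> Z x = z0 + integral {0..x} f"
    and x: "x \<in> {0..a}"
  shows "integral {0..x} (\<lambda>t. u' t * Z t + u t * f t) = u x * Z x - u 0 * z0"
proof -
  define G where "G \<equiv> \<lambda>x. integral {0..x} (\<lambda>t. cmod (f t))"
  define k where "k \<equiv> \<lambda>t. u' t * Z t + u t * f t"
  define F where "F \<equiv> \<lambda>x. u x * Z x - integral {0..x} k"
  have fint: "f integrable_on {0..a}" and fn: "(\<lambda>t. cmod (f t)) integrable_on {0..a}"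
    using f by (auto simp: absolutely_integrable_on_def)
  have u_cont: "continuous_on {0..a} u"
    using u by (meson continuous_on_eq_continuous_within has_vector_derivative_continuous)
  have Z_cont: "continuous_on {0..a} Z"
  proof -
    have "continuous_on {0..a} (\<lambda>x. z0 + integral {0..x} f)"
      by (intro continuous_intros indefinite_integral_continuous_1 fint)
    then show ?thesis using Z continuous_on_cong[of "{0..a}" "{0..a}" Z] by simp
  qed
  have uf: "(\<lambda>t. u t * f t) absolutely_integrable_on {0..a}"
    by (rule absolutely_integrable_continuous_mult[OF u_cont f])
  have u'Z: "(\<lambda>t. u' t * Z t) integrable_on {0..a}"
    by (intro integrable_continuous_real continuous_intros u' Z_cont)
  have k: "k integrable_on {0..a}"
    unfolding k_def using uf u'Z by (auto intro: integrable_add simp: absolutely_integrable_on_def)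
  obtain L where L: "\<And>t. t \<in> {0..a} \<Longrightarrow> cmod (u' t) \<le> L" and L0: "L \<ge> 0"
  proof -
    have "bounded (u' ` {0..a})"
      using u' by (simp add: compact_continuous_image compact_imp_bounded)
    then obtain B where "B > 0" "\<And>t. t \<in> {0..a} \<Longrightarrow> cmod (u' t) \<le> B"
      by (auto simp: bounded_pos)
    then show thesis by (intro that[of B]) auto
  qed
  have bound: "cmod (F t - F s) \<le> (t - s) * \<bar>2 * L * G t - 2 * L * G s\<bar>"
    if st: "0 \<le> s" "s \<le> t" "t \<le> a" for s t
  proof -
    have sub: "{s..t} \<subseteq> {0..a}" using st by auto
    have [simp]: "f absolutely_integrable_on {r..r'}" if "s \<le> r" "r' \<le> t" for r r'
      using absolutely_integrable_on_subinterval[OF f, of r r'] that st by auto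
    have Gd: "G t - G s = integral {s..t} (\<lambda>r. cmod (f r))"
      unfolding G_def by (rule integral_diff_indefinite[OF fn st])
    have Zd: "Z r' - Z r = integral {r..r'} f" if "s \<le> r" "r \<le> r'" "r' \<le> t" for r r'
      using that st by (subst (1 2) Z) (auto simp: integral_diff_indefinite[OF fint])
    have ud: "(u' has_integral (u t - u r)) {r..t}" if "s \<le> r" "r \<le> t" for r
      using that st u
      by (intro fundamental_theorem_of_calculus)
         (auto intro!: has_vector_derivative_within_subset[OF u])
    have ints: "(\<lambda>r. u' r * (Z s - Z r)) integrable_on {s..t}"
               "(\<lambda>r. (u t - u r) * f r) absolutely_integrable_on {s..t}"
      using continuous_on_subset[OF u' sub] continuous_on_subset[OF u_cont sub]
        continuous_on_subset[OF Z_cont sub]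
      by (auto intro!: integrable_continuous_real continuous_intros
          absolutely_integrable_continuous_mult)
    have eq: "F t - F s = integral {s..t} (\<lambda>r. u' r * (Z s - Z r)) + integral {s..t} (\<lambda>r. (u t - u r) * f r)"
    proof -
      have "integral {0..t} k - integral {0..s} k = integral {s..t} k"
        by (rule integral_diff_indefinite[OF k st])
      moreover have "((\<lambda>r. u' r * Z s + u t * f r) has_integral
                       ((u t - u s) * Z s + u t * (Z t - Z s))) {s..t}"
      proof (intro has_integral_add has_integral_mult_left has_integral_mult_right)
        show "(u' has_integral u t - u s) {s..t}" using ud[of s] st by auto
        show "(f has_integral Z t - Z s) {s..t}"
          using Zd[of s t] st integrable_on_subinterval[OF fint sub]
          by (auto simp: has_integral_integrable_integral)
      qed
      moreover have "integral {s..t} (\<lambda>r. u' r * (Z s - Z r)) + integral {s..t} (\<lambda>r. (u t - u r) * f r)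
          = integral {s..t} (\<lambda>r. u' r * (Z s - Z r) + (u t - u r) * f r)"
        using ints by (intro Henstock_Kurzweil_Integration.integral_add[symmetric])
                      (auto simp: absolutely_integrable_on_def)
      moreover have "\<dots> = integral {s..t} (\<lambda>r. (u' r * Z s + u t * f r) - k r)"
        by (rule arg_cong[where f="integral _"]) (auto simp: k_def algebra_simps)
      moreover have "\<dots> = integral {s..t} (\<lambda>r. u' r * Z s + u t * f r) - integral {s..t} k"
        by (rule Henstock_Kurzweil_Integration.integral_diff)
           (use calculation(2) integrable_on_subinterval[OF k sub] in \<open>auto simp: integrable_on_def\<close>)
      ultimately show ?thesis
        unfolding F_def by (simp add: has_integral_integrable_integral algebra_simps)
    qed
    have "cmod (integral {s..t} (\<lambda>r. u' r * (Z s - Z r))) \<le> (L * (G t - G s)) * (t - s)"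
    proof (rule integral_bound[OF st(2)])
      show "continuous_on {s..t} (\<lambda>r. u' r * (Z s - Z r))"
        using continuous_on_subset[OF u' sub] continuous_on_subset[OF Z_cont sub]
        by (intro continuous_intros)
      fix r assume r: "r \<in> {s..t}"
      have "cmod (Z s - Z r) = cmod (integral {s..r} f)"
        using Zd[of s r] r by (simp add: norm_minus_commute)
      also have "\<dots> \<le> integral {s..r} (\<lambda>r. cmod (f r))"
        using r norm_integral_le_mult[of f s r f 1] by (simp add: set_lebesgue_integral_eq_integral)
      also have "\<dots> \<le> integral {s..t} (\<lambda>r. cmod (f r))"
        using r by (intro integral_subset_le absolutely_integrable_cmod) auto
      finally show "cmod (u' r * (Z s - Z r)) \<le> L * (G t - G s)"
        using L[of r] L0 r sub Gd by (auto simp: norm_mult intro!: mult_mono)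
    qed
    moreover have "cmod (integral {s..t} (\<lambda>r. (u t - u r) * f r)) \<le>
        (L * (t - s)) * integral {s..t} (\<lambda>r. cmod (f r))"
    proof (rule norm_integral_le_mult)
      show "(\<lambda>r. (u t - u r) * f r) integrable_on {s..t}"
        using ints(2) by (simp add: absolutely_integrable_on_def)
      fix r assume r: "r \<in> {s..t}"
      have "cmod (u t - u r) \<le> L * (t - r)"
        using ud[of r] r L integral_bound[of r t u' L] st continuous_on_subset[OF u', of "{r..t}"]
        by (auto simp: has_integral_integrable_integral)
      also have "\<dots> \<le> L * (t - s)" using r L0 by (intro mult_left_mono) auto
      finally show "cmod ((u t - u r) * f r) \<le> L * (t - s) * cmod (f r)"
        by (simp add: norm_mult mult_right_mono)
    qed simp
    ultimately have "cmod (F t - F s) \<le> (L * (G t - G s)) * (t - s) + (L * (t - s)) * (G t - G s)"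
      unfolding eq Gd by (intro order_trans[OF norm_triangle_ineq add_mono])
    also have "\<dots> = (t - s) * (2 * L * (G t - G s))"
      by (simp add: algebra_simps)
    also have "\<dots> \<le> (t - s) * \<bar>2 * L * G t - 2 * L * G s\<bar>"
      using st by (intro mult_left_mono) (auto simp: algebra_simps)
    finally show ?thesis .
  qed
  have "continuous_on {0..a} (\<lambda>t. 2 * L * G t)"
    unfolding G_def by (intro continuous_intros indefinite_integral_continuous_1 fn)
  from has_vector_derivative_zero_if_increment_bound[of a _ F, OF this bound]
  have "(F has_derivative (\<lambda>h. 0)) (at t within {0..a})" if "t \<in> {0..a}" for t
    using that by (auto simp: has_vector_derivative_def)
  then have "F x = F 0"
    using has_derivative_zero_unique[of "{0..a}" F x 0] x a by auto
  then show ?thesis unfolding F_def k_def using Z[of 0] a by (simp add: algebra_simps)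
qed

section \<open>Functions with integrable second derivative\<close>

text \<open>
  The shape \<open>y'' = g\<close>, \<open>y 0 = c\<close>, \<open>y' 0 = d\<close> with \<open>v = y'\<close>. The right-hand side \<open>g\<close> is kept as an
  explicit argument, so the same predicate covers the homogeneous equation, the equation with a
  forcing term and smooth comparison functions. Derivatives are one-sided at the end points.
\<close>
definition twice_primitive ::
  "real \<Rightarrow> (real \<Rightarrow> complex) \<Rightarrow> complex \<Rightarrow> complex \<Rightarrow> (real \<Rightarrow> complex) \<Rightarrow> (real \<Rightarrow> complex) \<Rightarrow> bool" where
  "twice_primitive a g c d y v \<longleftrightarrow>
     g absolutely_integrable_on {0..a} \<and> y 0 = c \<and>
     (\<forall>x\<in>{0..a}. (y has_vector_derivative v x) (at x within {0..a}) \<and> v x = d + integral {0..x} g)"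

lemma twice_primitiveD:
  assumes "twice_primitive a g c d y v"
  shows "g absolutely_integrable_on {0..a}" "g integrable_on {0..a}" "y 0 = c"
    and "x \<in> {0..a} \<Longrightarrow> (y has_vector_derivative v x) (at x within {0..a})"
    and "x \<in> {0..a} \<Longrightarrow> v x = d + integral {0..x} g"
  using assms unfolding twice_primitive_def by (blast intro: set_lebesgue_integral_eq_integral(1))+

lemma twice_primitive_continuous:
  assumes "twice_primitive a g c d y v"
  shows "continuous_on {0..a} y" "continuous_on {0..a} v"
proof -
  show "continuous_on {0..a} y"
    using twice_primitiveD(4)[OF assms]
    by (meson continuous_on_eq_continuous_within has_vector_derivative_continuous)
  have "continuous_on {0..a} (\<lambda>x. d + integral {0..x} g)"
    by (intro continuous_intros indefinite_integral_continuous_1 twice_primitiveD(2)[OF assms])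
  then show "continuous_on {0..a} v"
    using twice_primitiveD(5)[OF assms] continuous_on_cong[of "{0..a}" "{0..a}" v] by simp
qed

lemma twice_primitive_exists:
  assumes g: "g absolutely_integrable_on {0..a}"
  shows "twice_primitive a g c d
           (\<lambda>x. c + integral {0..x} (\<lambda>s. d + integral {0..s} g)) (\<lambda>s. d + integral {0..s} g)"
proof -
  have "continuous_on {0..a} (\<lambda>s. d + integral {0..s} g)"
    using g by (intro continuous_intros indefinite_integral_continuous_1)
               (simp add: absolutely_integrable_on_def)
  from integral_has_vector_derivative[OF this]
  have "((\<lambda>x. c + integral {0..x} (\<lambda>s. d + integral {0..s} g)) has_vector_derivative
          0 + (d + integral {0..x} g)) (at x within {0..a})" if "x \<in> {0..a}" for x
    using that by (intro has_vector_derivative_add has_vector_derivative_const)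
  with g show ?thesis by (simp add: twice_primitive_def)
qed

lemma twice_primitive_cong:
  assumes "twice_primitive a g c d y v" "0 \<le> a"
    and "\<And>x. x \<in> {0..a} \<Longrightarrow> g x = g' x" "\<And>x. x \<in> {0..a} \<Longrightarrow> y x = y' x"
  shows "twice_primitive a g' c d y' v"
proof -
  have "g' absolutely_integrable_on {0..a}"
    using twice_primitiveD(1)[OF assms(1)] assms(3)
      set_integrable_cong[of lebesgue lebesgue "{0..a}" "{0..a}" g g'] by simp
  moreover have "y' 0 = c"
    using twice_primitiveD(3)[OF assms(1)] assms(2,4) by auto
  moreover have "(y' has_vector_derivative v x) (at x within {0..a})" if "x \<in> {0..a}" for x
    using has_vector_derivative_transform[OF that _ twice_primitiveD(4)[OF assms(1) that]] assms(4)
    by metis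
  moreover have "v x = d + integral {0..x} g'" if "x \<in> {0..a}" for x
    using twice_primitiveD(5)[OF assms(1) that] that assms(3)
      Henstock_Kurzweil_Integration.integral_cong[of "{0..x}" g g'] by auto
  ultimately show ?thesis by (simp add: twice_primitive_def)
qed

text \<open>
  Lets a property of the potential that holds almost everywhere, such as being real, be used as if it
  held everywhere.
\<close>
lemma twice_primitive_spike:
  assumes "twice_primitive a g c d y v" and N: "negligible N"
    and eq: "\<And>x. x \<in> {0..a} - N \<Longrightarrow> g' x = g x"
  shows "twice_primitive a g' c d y v"
proof -
  have "g' absolutely_integrable_on {0..a}"
    using twice_primitiveD(1)[OF assms(1)] N eq by (rule absolutely_integrable_spike)
  moreover have "integral {0..x} g = integral {0..x} g'" if "x \<in> {0..a}" for x
    using that eq by (intro integral_spike[OF N]) auto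
  ultimately show ?thesis
    using assms(1) unfolding twice_primitive_def by metis
qed

lemma twice_primitive_lincomb:
  assumes 1: "twice_primitive a g c d y v" and 2: "twice_primitive a h c' d' u w"
  shows "twice_primitive a (\<lambda>t. g t + k * h t) (c + k * c') (d + k * d')
           (\<lambda>x. y x + k * u x) (\<lambda>x. v x + k * w x)"
  unfolding twice_primitive_def
proof (intro conjI ballI)
  show "(\<lambda>t. g t + k * h t) absolutely_integrable_on {0..a}"
    by (intro set_integral_add(1) set_integrable_mult_right twice_primitiveD(1)[OF 1] twice_primitiveD(1)[OF 2])
  show "y 0 + k * u 0 = c + k * c'"
    using twice_primitiveD(3)[OF 1] twice_primitiveD(3)[OF 2] by simp
  fix x assume x: "x \<in> {0..a}"
  show "((\<lambda>x. y x + k * u x) has_vector_derivative v x + k * w x) (at x within {0..a})"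
    by (intro has_vector_derivative_add has_vector_derivative_mult_right
        twice_primitiveD(4)[OF 1 x] twice_primitiveD(4)[OF 2 x])
  have "g integrable_on {0..x}" "h integrable_on {0..x}"
    using twice_primitiveD(2)[OF 1] twice_primitiveD(2)[OF 2] x
    by (auto intro: integrable_on_subinterval)
  then show "v x + k * w x = d + k * d' + integral {0..x} (\<lambda>t. g t + k * h t)"
    using twice_primitiveD(5)[OF 1 x] twice_primitiveD(5)[OF 2 x]
    using Henstock_Kurzweil_Integration.integral_add[of g "{0..x}" "\<lambda>t. k * h t"]
    by (simp add: integrable_on_mult_right algebra_simps)
qed

lemma twice_primitive_cnj:
  assumes 1: "twice_primitive a g c d y v"
  shows "twice_primitive a (\<lambda>t. cnj (g t)) (cnj c) (cnj d) (\<lambda>x. cnj (y x)) (\<lambda>x. cnj (v x))"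
  unfolding twice_primitive_def
proof (intro conjI ballI)
  show "(\<lambda>t. cnj (g t)) absolutely_integrable_on {0..a}"
    using absolutely_integrable_linear[OF twice_primitiveD(1)[OF 1] bounded_linear_cnj]
    by (simp add: o_def)
  show "cnj (y 0) = cnj c" using twice_primitiveD(3)[OF 1] by simp
  fix x assume x: "x \<in> {0..a}"
  show "((\<lambda>x. cnj (y x)) has_vector_derivative cnj (v x)) (at x within {0..a})"
    by (intro has_vector_derivative_cnj twice_primitiveD(4)[OF 1 x])
  have "g integrable_on {0..x}"
    using twice_primitiveD(2)[OF 1] x by (auto intro: integrable_on_subinterval)
  then show "cnj (v x) = cnj d + integral {0..x} (\<lambda>t. cnj (g t))"
    using twice_primitiveD(5)[OF 1 x] integral_linear[OF _ bounded_linear_cnj, of g "{0..x}"]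
    by (simp add: o_def)
qed

text \<open>
  Two integrations by parts, in which the products of first derivatives cancel.
\<close>
lemma green_identity:
  assumes 1: "twice_primitive a g c d y v" and 2: "twice_primitive a h c' d' u w"
    and x: "x \<in> {0..a}"
  shows "integral {0..x} (\<lambda>t. u t * g t - h t * y t) = (u x * v x - w x * y x) - (c' * d - d' * c)"
proof -
  have a: "0 \<le> a" using x by simp
  note c1 = twice_primitive_continuous[OF 1] and c2 = twice_primitive_continuous[OF 2]
  have I1: "integral {0..x} (\<lambda>t. w t * v t + u t * g t) = u x * v x - u 0 * d"
    using a twice_primitiveD(4)[OF 2] c2(2) twice_primitiveD(1)[OF 1] twice_primitiveD(5)[OF 1] x
    by (rule integral_product_rule)
  have I2: "integral {0..x} (\<lambda>t. v t * w t + y t * h t) = y x * w x - y 0 * d'"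
    using a twice_primitiveD(4)[OF 1] c1(2) twice_primitiveD(1)[OF 2] twice_primitiveD(5)[OF 2] x
    by (rule integral_product_rule)
  have sub: "{0..x} \<subseteq> {0..a}" using x by auto
  have wv: "(\<lambda>t. w t * v t) integrable_on {0..x}" "(\<lambda>t. v t * w t) integrable_on {0..x}"
    using c1(2) c2(2) sub
    by (auto intro!: integrable_continuous_real continuous_intros intro: continuous_on_subset)
  have ug: "(\<lambda>t. u t * g t) integrable_on {0..x}" "(\<lambda>t. y t * h t) integrable_on {0..x}"
    using absolutely_integrable_on_subinterval[OF
        absolutely_integrable_continuous_mult[OF c2(1) twice_primitiveD(1)[OF 1]] sub]
      absolutely_integrable_on_subinterval[OF
        absolutely_integrable_continuous_mult[OF c1(1) twice_primitiveD(1)[OF 2]] sub]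
    by (simp_all add: absolutely_integrable_on_def)
  have "integral {0..x} (\<lambda>t. u t * g t - h t * y t) =
        integral {0..x} (\<lambda>t. (w t * v t + u t * g t) - (v t * w t + y t * h t))"
    by (rule arg_cong[where f = "integral _"]) (auto simp: algebra_simps)
  also have "\<dots> = integral {0..x} (\<lambda>t. w t * v t + u t * g t) - integral {0..x} (\<lambda>t. v t * w t + y t * h t)"
    by (intro Henstock_Kurzweil_Integration.integral_diff integrable_add wv ug)
  finally show ?thesis
    unfolding I1 I2 using twice_primitiveD(3)[OF 1] twice_primitiveD(3)[OF 2]
    by (simp add: algebra_simps)
qed

section \<open>Second-order Volterra equations\<close>

text \<open>
  One Picard step halves the weight factor: the weight \<open>exp (2 K x)\<close> grows fast enough that
  integrating \<open>K m exp (2 K x)\<close> costs only \<open>m / 2 exp (2 K x)\<close>. Here \<open>z\<close> is the function inserted on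
  the right-hand side and \<open>y\<close> the resulting one; taking \<open>y = z\<close> gives an a priori bound, and taking
  differences of iterates gives a contraction.
\<close>
lemma volterra_step:
  fixes p f z :: "real \<Rightarrow> complex"
  assumes p: "p absolutely_integrable_on {0..a}" and f: "f absolutely_integrable_on {0..a}"
    and y: "twice_primitive a (\<lambda>t. p t * z t + f t) c d y v"
    and K: "K = integral {0..a} (\<lambda>t. cmod (p t))"
    and z: "\<And>t. t \<in> {0..a} \<Longrightarrow> cmod (z t) \<le> m * exp (2 * K * t)"
    and x: "x \<in> {0..a}"
  shows "cmod (y x) \<le> cmod c + a * (cmod d + integral {0..a} (\<lambda>t. cmod (f t))) + m / 2 * exp (2 * K * x)"
proof -
  define D where "D = cmod d + integral {0..a} (\<lambda>t. cmod (f t))"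
  have D: "D \<ge> 0"
    unfolding D_def by (intro add_nonneg_nonneg Henstock_Kurzweil_Integration.integral_nonneg
        absolutely_integrable_cmod f) auto
  have K0: "K \<ge> 0"
    unfolding K by (intro Henstock_Kurzweil_Integration.integral_nonneg absolutely_integrable_cmod p) auto
  have m: "m \<ge> 0"
    using z[of 0] x norm_ge_zero[of "z 0"] by (auto simp del: norm_ge_zero)
  have v: "cmod (v s) \<le> D + m * K * exp (2 * K * s)" if s: "s \<in> {0..a}" for s
  proof -
    let ?g = "\<lambda>t. p t * z t + f t"
    have sub: "{0..s} \<subseteq> {0..a}" using s by auto
    have ps: "(\<lambda>t. cmod (p t)) integrable_on {0..s}" "(\<lambda>t. cmod (f t)) integrable_on {0..s}"
      using absolutely_integrable_on_subinterval[OF p sub] absolutely_integrable_on_subinterval[OF f sub]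
      by (auto intro: absolutely_integrable_cmod)
    have "cmod (integral {0..s} ?g) \<le>
          integral {0..s} (\<lambda>t. m * exp (2 * K * s) * cmod (p t) + cmod (f t))"
    proof (rule integral_norm_bound_integral)
      show "?g integrable_on {0..s}"
        using integrable_on_subinterval[OF twice_primitiveD(2)[OF y] sub] .
      show "(\<lambda>t. m * exp (2 * K * s) * cmod (p t) + cmod (f t)) integrable_on {0..s}"
        by (intro integrable_add integrable_on_mult_right ps)
      fix t assume t: "t \<in> {0..s}"
      have "cmod (z t) \<le> m * exp (2 * K * t)" using t sub z by blast
      also have "\<dots> \<le> m * exp (2 * K * s)"
        using m t K0 by (intro mult_left_mono) (auto intro!: mult_left_mono)
      finally have "cmod (p t * z t) \<le> m * exp (2 * K * s) * cmod (p t)"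
        by (simp add: norm_mult mult.commute mult_left_mono)
      then show "cmod (?g t) \<le> m * exp (2 * K * s) * cmod (p t) + cmod (f t)"
        using norm_triangle_ineq[of "p t * z t" "f t"] by linarith
    qed
    also have "\<dots> = m * exp (2 * K * s) * integral {0..s} (\<lambda>t. cmod (p t)) + integral {0..s} (\<lambda>t. cmod (f t))"
      using ps by (simp add: Henstock_Kurzweil_Integration.integral_add integrable_on_mult_right)
    also have "\<dots> \<le> m * exp (2 * K * s) * K + integral {0..a} (\<lambda>t. cmod (f t))"
      unfolding K using m
      by (intro add_mono mult_left_mono integral_subset_le sub ps absolutely_integrable_cmod p f) auto
    finally have "cmod (integral {0..s} ?g) \<le> \<dots>" .
    then show ?thesis
      using twice_primitiveD(5)[OF y s] norm_triangle_ineq[of d "integral {0..s} ?g"]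
      unfolding D_def by (simp add: algebra_simps)
  qed
  \<comment> \<open>majorises the increments of \<open>y\<close>, since its derivative is the bound just obtained for \<open>v\<close>\<close>
  define \<phi> where "\<phi> \<equiv> \<lambda>s. D * s + m / 2 * exp (2 * K * s)"
  have "cmod (y x - y 0) \<le> \<phi> x - \<phi> 0"
  proof (cases "x = 0")
    case False
    show ?thesis
    proof (rule differentiable_bound_general)
      show "0 < x" using False x by auto
      show "continuous_on {0..x} y"
        using twice_primitive_continuous(1)[OF y] by (rule continuous_on_subset) (use x in auto)
      show "continuous_on {0..x} \<phi>" unfolding \<phi>_def by (intro continuous_intros)
      fix s assume s: "0 < s" "s < x"
      show "(\<phi> has_vector_derivative D + m * K * exp (2 * K * s)) (at s)"
        unfolding \<phi>_def has_real_derivative_iff_has_vector_derivative[symmetric]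
        by (auto intro!: derivative_eq_intros)
      have "(y has_vector_derivative v s) (at s within {0..a})"
        using s x by (intro twice_primitiveD(4)[OF y]) auto
      then show "(y has_vector_derivative v s) (at s)"
        using s x at_within_interior[of s "{0..a}"] by auto
      show "cmod (v s) \<le> D + m * K * exp (2 * K * s)" using v s x by auto
    qed
  qed simp
  moreover have "D * x \<le> a * D" using mult_left_mono[of x a D] x D by (simp add: mult.commute)
  moreover have "cmod (y x) \<le> cmod (y x - y 0) + cmod c"
    using twice_primitiveD(3)[OF y] norm_triangle_sub[of "y x" "y 0"] by simp
  ultimately show ?thesis
    using m unfolding \<phi>_def D_def by simp
qed

text \<open>
  At a point where \<open>\<bar>y x\<bar> exp (- 2 K x)\<close> is maximal, with value \<open>m\<close>, one Picard step gives
  \<open>m \<le> A + m / 2\<close>, where \<open>A\<close> collects the data; so \<open>m \<le> 2 A\<close>.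
\<close>
lemma volterra_bound:
  fixes p f y :: "real \<Rightarrow> complex"
  assumes p: "p absolutely_integrable_on {0..a}" and f: "f absolutely_integrable_on {0..a}"
    and y: "twice_primitive a (\<lambda>t. p t * y t + f t) c d y v"
    and x: "x \<in> {0..a}"
  shows "cmod (y x) \<le> 2 * exp (2 * a * integral {0..a} (\<lambda>t. cmod (p t))) *
           (cmod c + a * (cmod d + integral {0..a} (\<lambda>t. cmod (f t))))"
proof -
  define K where "K = integral {0..a} (\<lambda>t. cmod (p t))"
  define A where "A = cmod c + a * (cmod d + integral {0..a} (\<lambda>t. cmod (f t)))"
  have a: "0 \<le> a" using x by auto
  have K0: "K \<ge> 0"
    unfolding K_def by (intro Henstock_Kurzweil_Integration.integral_nonneg absolutely_integrable_cmod p) auto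
  have "continuous_on {0..a} (\<lambda>t. cmod (y t) * exp (- 2 * K * t))"
    using twice_primitive_continuous(1)[OF y] by (intro continuous_intros)
  with continuous_attains_sup[of "{0..a}" "\<lambda>t. cmod (y t) * exp (- 2 * K * t)"] a
  obtain x0 where x0: "x0 \<in> {0..a}"
    and "\<And>t. t \<in> {0..a} \<Longrightarrow> cmod (y t) * exp (- 2 * K * t) \<le> cmod (y x0) * exp (- 2 * K * x0)"
    by fastforce
  moreover define m where "m = cmod (y x0) * exp (- 2 * K * x0)"
  ultimately have "cmod (y t) * exp (- 2 * K * t) \<le> m" if "t \<in> {0..a}" for t
    using that by simp
  then have m: "cmod (y t) \<le> m * exp (2 * K * t)" if "t \<in> {0..a}" for t
    using mult_right_mono[of "cmod (y t) * exp (- 2 * K * t)" m "exp (2 * K * t)"] that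
    by (simp add: mult.assoc flip: exp_add)
  have "m * exp (2 * K * x0) = cmod (y x0)" by (simp add: m_def exp_minus)
  also have "\<dots> \<le> A + m / 2 * exp (2 * K * x0)"
    unfolding A_def by (rule volterra_step[OF p f y K_def m x0])
  finally have "m * exp (2 * K * x0) \<le> 2 * A" by simp
  moreover have "m * 1 \<le> m * exp (2 * K * x0)"
    using x0 K0 by (intro mult_left_mono) (auto simp: m_def)
  ultimately have "m \<le> 2 * A" by simp
  have "cmod (y x) \<le> m * exp (2 * K * x)" by (rule m[OF x])
  also have "\<dots> \<le> m * exp (2 * a * K)"
    using x K0 mult_right_mono[of x a "2 * K"]
    by (intro mult_left_mono) (auto simp: m_def mult_ac)
  also have "\<dots> \<le> 2 * A * exp (2 * a * K)"
    using \<open>m \<le> 2 * A\<close> by (intro mult_right_mono) auto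
  finally show ?thesis by (simp add: A_def K_def algebra_simps)
qed

lemma volterra_unique:
  fixes p f y u :: "real \<Rightarrow> complex"
  assumes p: "p absolutely_integrable_on {0..a}"
    and 1: "twice_primitive a (\<lambda>t. p t * y t + f t) c d y v"
    and 2: "twice_primitive a (\<lambda>t. p t * u t + f t) c d u w"
    and x: "x \<in> {0..a}"
  shows "y x = u x" "v x = w x"
proof -
  have a: "0 \<le> a" using x by auto
  have "twice_primitive a (\<lambda>t. p t * (y t + (-1) * u t) + 0) 0 0 (\<lambda>x. y x + (-1) * u x) (\<lambda>x. v x + (-1) * w x)"
    using twice_primitive_cong[OF twice_primitive_lincomb[OF 1 2, of "-1"] a]
    by (auto simp: algebra_simps)
  from volterra_bound[OF p _ this] have eq: "y t = u t" if "t \<in> {0..a}" for t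
    using that by simp
  then show "y x = u x" using x .
  have "integral {0..x} (\<lambda>t. p t * y t + f t) = integral {0..x} (\<lambda>t. p t * u t + f t)"
    using eq x by (intro Henstock_Kurzweil_Integration.integral_cong) auto
  then show "v x = w x"
    using twice_primitiveD(5)[OF 1 x] twice_primitiveD(5)[OF 2 x] by simp
qed

text \<open>
  Picard iteration. Successive differences decay like \<open>2\<^sup>-\<^sup>n\<close> in the weighted norm, so the iterates
  converge uniformly, and the limit is a fixed point by the same contraction estimate.
\<close>
lemma volterra_exists:
  fixes p f :: "real \<Rightarrow> complex"
  assumes a: "0 \<le> a" and p: "p absolutely_integrable_on {0..a}" and f: "f absolutely_integrable_on {0..a}"
  obtains y v where "twice_primitive a (\<lambda>t. p t * y t + f t) c d y v"
proof -
  define K where "K = integral {0..a} (\<lambda>t. cmod (p t))"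
  have K0: "K \<ge> 0"
    unfolding K_def by (intro Henstock_Kurzweil_Integration.integral_nonneg absolutely_integrable_cmod p) auto
  define V where "V \<equiv> \<lambda>y s. d + integral {0..s} (\<lambda>t. p t * y t + f t)"
  define T where "T \<equiv> \<lambda>y x. c + integral {0..x} (V y)"
  have T: "twice_primitive a (\<lambda>t. p t * y t + f t) c d (T y) (V y)" if "continuous_on {0..a} y" for y
    unfolding T_def V_def using absolutely_integrable_continuous_mult[OF that p] f
    by (intro twice_primitive_exists set_integral_add(1)) (simp_all add: mult.commute)
  have contraction: "cmod (T y x - T u x) \<le> m / 2 * exp (2 * K * x)"
    if y: "continuous_on {0..a} y" and u: "continuous_on {0..a} u"
      and le: "\<And>t. t \<in> {0..a} \<Longrightarrow> cmod (y t - u t) \<le> m * exp (2 * K * t)" and x: "x \<in> {0..a}"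
    for y u m x
  proof -
    have "twice_primitive a (\<lambda>t. p t * (y t - u t) + 0) 0 0 (\<lambda>x. T y x + (-1) * T u x) (\<lambda>x. V y x + (-1) * V u x)"
      using twice_primitive_cong[OF twice_primitive_lincomb[OF T[OF y] T[OF u], of "-1"] a]
      by (auto simp: algebra_simps)
    from volterra_step[OF p _ this K_def le x] show ?thesis by simp
  qed
  define Z where "Z n = (T ^^ n) (\<lambda>_. 0)" for n
  have ZS: "Z (Suc n) = T (Z n)" for n by (simp add: Z_def)
  have Z_cont: "continuous_on {0..a} (Z n)" for n
  proof (induction n)
    case 0 then show ?case by (simp add: Z_def)
  next
    case (Suc n) then show ?case using twice_primitive_continuous(1)[OF T] by (simp add: ZS)
  qed
  obtain M where M: "\<And>t. t \<in> {0..a} \<Longrightarrow> cmod (Z 1 t - Z 0 t) \<le> M" and M0: "M > 0"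
  proof -
    have "bounded ((\<lambda>t. Z 1 t - Z 0 t) ` {0..a})"
      by (intro compact_imp_bounded compact_continuous_image continuous_intros Z_cont) auto
    then obtain b where "b > 0" "\<And>t. t \<in> {0..a} \<Longrightarrow> cmod (Z 1 t - Z 0 t) \<le> b"
      unfolding bounded_pos by blast
    then show thesis by (intro that[of b])
  qed
  have step: "\<forall>t\<in>{0..a}. cmod (Z (Suc n) t - Z n t) \<le> (M / 2 ^ n) * exp (2 * K * t)" for n
  proof (induction n)
    case 0
    have "cmod (Z 1 t - Z 0 t) \<le> M * exp (2 * K * t)" if "t \<in> {0..a}" for t
    proof -
      have "M * 1 \<le> M * exp (2 * K * t)"
        using that K0 M0 by (intro mult_left_mono) auto
      with M[OF that] show ?thesis by simp
    qed
    then show ?case by simp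
  next
    case (Suc n)
    then show ?case
      using contraction[OF Z_cont[of "Suc n"] Z_cont[of n], of "M / 2 ^ n"]
      by (auto simp: ZS[symmetric] mult.commute)
  qed
  have "uniform_limit {0..a} (\<lambda>n x. \<Sum>i<n. Z (Suc i) x - Z i x) (\<lambda>x. \<Sum>i. Z (Suc i) x - Z i x) sequentially"
  proof (rule Weierstrass_m_test)
    fix n x assume x: "x \<in> {0..a}"
    have "cmod (Z (Suc n) x - Z n x) \<le> (M / 2 ^ n) * exp (2 * K * x)" using step x by blast
    also have "\<dots> \<le> (M / 2 ^ n) * exp (2 * K * a)"
      using x K0 M0 by (intro mult_left_mono) (auto intro!: mult_left_mono)
    finally show "cmod (Z (Suc n) x - Z n x) \<le> (M * exp (2 * K * a)) * (1 / 2) ^ n"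
      by (simp add: power_divide mult_ac)
  next
    show "summable (\<lambda>n. (M * exp (2 * K * a)) * (1 / 2) ^ n)"
      by (intro summable_mult summable_geometric) auto
  qed
  moreover have "(\<Sum>i<n. Z (Suc i) x - Z i x) = Z n x" for n x
    using sum_lessThan_telescope[of "\<lambda>i. Z i x" n] by (simp add: Z_def[of 0])
  ultimately obtain y where lim: "uniform_limit {0..a} Z y sequentially"
    by auto
  have y: "continuous_on {0..a} y"
    by (rule uniform_limit_theorem[OF _ lim]) (auto simp: Z_cont)
  have fixpoint: "T y x = y x" if x: "x \<in> {0..a}" for x
  proof (rule LIMSEQ_unique)
    show "(\<lambda>n. Z (Suc n) x) \<longlonglongrightarrow> y x"
      using tendsto_uniform_limitI[OF lim x] by (rule LIMSEQ_Suc)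
    show "(\<lambda>n. Z (Suc n) x) \<longlonglongrightarrow> T y x"
    proof (rule tendstoI)
      fix e :: real assume e: "e > 0"
      define e' where "e' = e / exp (2 * K * a)"
      have e': "e' > 0" using e by (simp add: e'_def)
      have "\<forall>\<^sub>F n in sequentially. \<forall>t\<in>{0..a}. dist (Z n t) (y t) < e'"
        using uniform_limitD[OF lim e'] .
      then show "\<forall>\<^sub>F n in sequentially. dist (Z (Suc n) x) (T y x) < e"
      proof eventually_elim
        case (elim n)
        have "cmod (T (Z n) x - T y x) \<le> e' / 2 * exp (2 * K * x)"
        proof (rule contraction[OF Z_cont y _ x])
          fix t assume t: "t \<in> {0..a}"
          have "e' * 1 \<le> e' * exp (2 * K * t)"
            using e' t K0 by (intro mult_left_mono) auto
          with elim t show "cmod (Z n t - y t) \<le> e' * exp (2 * K * t)"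
            by (force simp: dist_norm)
        qed
        also have "\<dots> \<le> e' / 2 * exp (2 * K * a)"
          using e' x K0 by (intro mult_left_mono) (auto intro!: mult_left_mono)
        also have "\<dots> < e" using e by (simp add: e'_def)
        finally show ?case by (simp add: dist_norm ZS)
      qed
    qed
  qed
  have "twice_primitive a (\<lambda>t. p t * y t + f t) c d y (V y)"
    using twice_primitive_cong[OF T[OF y] a] fixpoint by simp
  then show thesis by (rule that)
qed

section \<open>Dependence of the solution on the spectral parameter\<close>

text \<open>
  The interval is bounded and \<open>\<bar>q\<bar> \<le> 1 + \<bar>q\<bar>\<^sup>2\<close>.
\<close>
lemma square_integrable_imp_absolutely_integrable:
  assumes "square_integrable a q"
  shows "q absolutely_integrable_on {0..a}"
proof -
  have "set_integrable lebesgue {0<..<a} (\<lambda>x. 1 + (cmod (q x))\<^sup>2)"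
    using assms
    by (intro set_integral_add(1)) (auto simp: square_integrable_def absolutely_integrable_on_const)
  then have "q absolutely_integrable_on {0<..<a}"
  proof (rule set_integrable_bound)
    show "set_borel_measurable lebesgue {0<..<a} q"
      using assms by (simp add: square_integrable_def)
    have "cmod (q x) \<le> 1 + (cmod (q x))\<^sup>2" for x
      using sum_power2_ge_zero[of "cmod (q x) - 1" 0] norm_ge_zero[of "q x"]
      by (simp add: power2_eq_square algebra_simps del: norm_ge_zero)
    then show "AE x in lebesgue. x \<in> {0<..<a} \<longrightarrow> cmod (q x) \<le> norm (1 + (cmod (q x))\<^sup>2)"
      by auto
  qed
  then show ?thesis
  proof (rule absolutely_integrable_spike_set)
    show "negligible {x \<in> {0<..<a} - {0..a}. q x \<noteq> 0}"
      by (rule negligible_subset[of "{}"]) auto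
    show "negligible {x \<in> {0..a} - {0<..<a}. q x \<noteq> 0}"
      by (rule negligible_subset[of "{0, a}"]) auto
  qed
qed

text \<open>
  The equation holds only almost everywhere, but the integral of the second derivative does not see
  the exceptional set; so \<open>y2\<close> may be replaced by \<open>(q - z\<^sup>2) y\<close> throughout.
\<close>
lemma sl_solution_imp_twice_primitive:
  assumes a: "0 < a" and q: "q absolutely_integrable_on {0..a}"
    and y: "sl_solution a q z y" and c: "y 0 = c" and d: "deriv_on a y 0 = d"
  shows "twice_primitive a (\<lambda>t. (q t - z\<^sup>2) * y t) c d y (deriv_on a y)"
proof -
  obtain y1 y2 where y1: "\<And>x. x \<in> {0..a} \<Longrightarrow> (y has_vector_derivative y1 x) (at x within {0..a})"
    and y2: "set_integrable lebesgue {0..a} y2"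
    and int: "\<And>x. x \<in> {0..a} \<Longrightarrow> y1 x = y1 0 + (LINT t:{0..x}|lebesgue. y2 t)"
    and eq: "AE x in lebesgue. x \<in> {0<..<a} \<longrightarrow> - y2 x + q x * y x = z\<^sup>2 * y x"
    using y unfolding sl_solution_def by blast
  have deriv: "deriv_on a y x = y1 x" if "x \<in> {0..a}" for x
    unfolding deriv_on_def using vector_derivative_within_closed_interval[OF a that y1[OF that]] .
  obtain N where N: "negligible N" "\<And>x. x \<notin> N \<Longrightarrow> x \<in> {0<..<a} \<Longrightarrow> - y2 x + q x * y x = z\<^sup>2 * y x"
    using eq unfolding eventually_ae_filter_negligible by blast
  have "continuous_on {0..a} y"
    using y1 by (meson continuous_on_eq_continuous_within has_vector_derivative_continuous)
  then have "(\<lambda>t. (q t - z\<^sup>2) * y t) absolutely_integrable_on {0..a}"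
    using absolutely_integrable_continuous_mult[of 0 a y "\<lambda>t. q t - z\<^sup>2"] q
    by (simp add: set_integral_diff(1) absolutely_integrable_on_const mult.commute)
  moreover have "(LINT t:{0..x}|lebesgue. y2 t) = integral {0..x} (\<lambda>t. (q t - z\<^sup>2) * y t)"
    if "x \<in> {0..a}" for x
  proof -
    have "y2 absolutely_integrable_on {0..x}"
      using absolutely_integrable_on_subinterval[OF y2] that by auto
    then have "(LINT t:{0..x}|lebesgue. y2 t) = integral {0..x} y2"
      by (rule set_lebesgue_integral_eq_integral(2))
    also have "\<dots> = integral {0..x} (\<lambda>t. (q t - z\<^sup>2) * y t)"
    proof (rule integral_spike)
      show "negligible (N \<union> {0, a})" using N(1) by (simp add: negligible_Un)
      fix t assume "t \<in> {0..x} - (N \<union> {0, a})"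
      then have "- y2 t + q t * y t = z\<^sup>2 * y t" using that by (intro N(2)) auto
      then show "(q t - z\<^sup>2) * y t = y2 t" by (simp add: algebra_simps)
    qed
    finally show ?thesis .
  qed
  moreover have "deriv_on a y x = d + (LINT t:{0..x}|lebesgue. y2 t)" if "x \<in> {0..a}" for x
    using int[OF that] deriv[OF that] deriv[of 0] d a by simp
  ultimately show ?thesis
    unfolding twice_primitive_def using deriv y1 c by (intro conjI ballI) simp_all
qed

lemma twice_primitive_imp_sl_solution:
  assumes a: "0 < a" and y: "twice_primitive a (\<lambda>t. (q t - z\<^sup>2) * y t) c d y v"
  shows "sl_solution a q z y" and "x \<in> {0..a} \<Longrightarrow> deriv_on a y x = v x"
proof -
  show "deriv_on a y x = v x" if "x \<in> {0..a}" for x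
    unfolding deriv_on_def
    using vector_derivative_within_closed_interval[OF a that twice_primitiveD(4)[OF y that]] .
  have "v x = v 0 + (LINT t:{0..x}|lebesgue. (q t - z\<^sup>2) * y t)" if "x \<in> {0..a}" for x
  proof -
    have "(\<lambda>t. (q t - z\<^sup>2) * y t) absolutely_integrable_on {0..x}"
      using absolutely_integrable_on_subinterval[OF twice_primitiveD(1)[OF y]] that by auto
    then show ?thesis
      using twice_primitiveD(5)[OF y that] twice_primitiveD(5)[OF y, of 0] a
      by (simp add: set_lebesgue_integral_eq_integral(2))
  qed
  moreover have "AE x in lebesgue. x \<in> {0<..<a} \<longrightarrow> - ((q x - z\<^sup>2) * y x) + q x * y x = z\<^sup>2 * y x"
    by (intro AE_I2 impI) (simp add: algebra_simps)
  ultimately show "sl_solution a q z y"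
    unfolding sl_solution_def using twice_primitiveD(1,4)[OF y]
    by (intro exI[of _ v] exI[of _ "\<lambda>t. (q t - z\<^sup>2) * y t"] conjI ballI)
qed

lemma has_field_derivative_if_quadratic_bound:
  fixes f :: "complex \<Rightarrow> complex"
  assumes "\<And>w. cmod (w - z) \<le> 1 \<Longrightarrow> cmod (f w - f z - (w - z) * D) \<le> C * (cmod (w - z))\<^sup>2"
  shows "(f has_field_derivative D) (at z)"
proof -
  have "((\<lambda>w. (f w - f z) / (w - z) - D) \<longlongrightarrow> 0) (at z)"
  proof (rule Lim_null_comparison)
    show "((\<lambda>w. C * cmod (w - z)) \<longlongrightarrow> 0) (at z)"
      by (auto intro!: tendsto_eq_intros)
    have "\<forall>\<^sub>F w in at z. w \<noteq> z \<and> dist w z < 1"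
      by (auto simp: eventually_at intro!: exI[of _ 1])
    then show "\<forall>\<^sub>F w in at z. cmod ((f w - f z) / (w - z) - D) \<le> C * cmod (w - z)"
    proof eventually_elim
      case (elim w)
      have "(f w - f z) / (w - z) - D = (f w - f z - (w - z) * D) / (w - z)"
        using elim by (simp add: field_simps)
      moreover have "cmod (f w - f z - (w - z) * D) \<le> (C * cmod (w - z)) * cmod (w - z)"
        using assms[of w] elim by (simp add: dist_norm power2_eq_square mult.assoc)
      ultimately show ?case
        using elim by (simp add: norm_divide pos_divide_le_eq)
    qed
  qed
  then show ?thesis by (simp add: has_field_derivative_iff LIM_zero_iff)
qed

locale sturm_liouville =
  fixes a :: real and q :: "real \<Rightarrow> complex" and \<alpha>\<^sub>0 :: real and \<beta>\<^sub>0 :: complex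
  assumes a: "0 < a" and q: "q absolutely_integrable_on {0..a}"
begin

abbreviation Y :: "complex \<Rightarrow> real \<Rightarrow> complex" where
  "Y z \<equiv> sl_sol a q \<alpha>\<^sub>0 \<beta>\<^sub>0 z"

abbreviation Y' :: "complex \<Rightarrow> real \<Rightarrow> complex" where
  "Y' z \<equiv> deriv_on a (Y z)"

lemma potential_integrable: "(\<lambda>t. q t - z\<^sup>2) absolutely_integrable_on {0..a}"
  using q by (intro set_integral_diff(1)) (auto simp: absolutely_integrable_on_const)

lemma Y_solves:
  "twice_primitive a (\<lambda>t. (q t - z\<^sup>2) * Y z t) 1 (\<i> * of_real \<alpha>\<^sub>0 * z + \<beta>\<^sub>0) (Y z) (Y' z)"
proof -
  obtain y v where "twice_primitive a (\<lambda>t. (q t - z\<^sup>2) * y t + 0) 1 (\<i> * of_real \<alpha>\<^sub>0 * z + \<beta>\<^sub>0) y v"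
    by (rule volterra_exists[OF less_imp_le[OF a] potential_integrable]) auto
  then have y: "twice_primitive a (\<lambda>t. (q t - z\<^sup>2) * y t) 1 (\<i> * of_real \<alpha>\<^sub>0 * z + \<beta>\<^sub>0) y v"
    by simp
  have "sl_solution a q z y \<and> y 0 = 1 \<and> deriv_on a y 0 = \<i> * of_real \<alpha>\<^sub>0 * z + \<beta>\<^sub>0"
    using twice_primitive_imp_sl_solution[OF a y] twice_primitiveD(3)[OF y]
      twice_primitiveD(5)[OF y, of 0] a by auto
  then have "sl_solution a q z (Y z) \<and> Y z 0 = 1 \<and> deriv_on a (Y z) 0 = \<i> * of_real \<alpha>\<^sub>0 * z + \<beta>\<^sub>0"
    unfolding sl_sol_def
    by (rule someI[of "\<lambda>y. sl_solution a q z y \<and> y 0 = 1 \<and>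
          deriv_on a y 0 = \<i> * of_real \<alpha>\<^sub>0 * z + \<beta>\<^sub>0"])
  then show ?thesis
    using sl_solution_imp_twice_primitive[OF a q] by blast
qed

lemma Y_at_0 [simp]: "Y z 0 = 1"
  using twice_primitiveD(3)[OF Y_solves] .

lemma Y_continuous: "continuous_on {0..a} (Y z)"
  using twice_primitive_continuous(1)[OF Y_solves] .

text \<open>
  The constant is uniform for \<open>z\<close> in a disc. This is what turns a forcing term of size \<open>\<bar>h\<bar>\<^sup>2\<close> into a
  remainder of size \<open>\<bar>h\<bar>\<^sup>2\<close> when the spectral parameter is moved by \<open>h\<close>.
\<close>
lemma solution_bound:
  "\<exists>C. \<forall>z f y v m. cmod z \<le> R \<and> continuous_on {0..a} f \<and>
      twice_primitive a (\<lambda>t. (q t - z\<^sup>2) * y t + f t) 0 0 y v \<and> (\<forall>t\<in>{0..a}. cmod (f t) \<le> m) \<longrightarrow>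
      (\<forall>x\<in>{0..a}. cmod (y x) \<le> C * m \<and> cmod (v x) \<le> C * m)"
proof -
  define K where "K = integral {0..a} (\<lambda>t. cmod (q t)) + a * R\<^sup>2"
  define B where "B = 2 * exp (2 * a * K) * a\<^sup>2"
  have K0: "K \<ge> 0"
    unfolding K_def using a by (intro add_nonneg_nonneg
        Henstock_Kurzweil_Integration.integral_nonneg absolutely_integrable_cmod q) auto
  have B0: "B \<ge> 0" by (simp add: B_def)
  have "cmod (y x) \<le> (B + K * B + a) * m \<and> cmod (v x) \<le> (B + K * B + a) * m"
    if z: "cmod z \<le> R" and f: "continuous_on {0..a} f"
      and y: "twice_primitive a (\<lambda>t. (q t - z\<^sup>2) * y t + f t) 0 0 y v" and x: "x \<in> {0..a}"
      and m: "\<And>t. t \<in> {0..a} \<Longrightarrow> cmod (f t) \<le> m" for z f y v x m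
  proof -
    have m0: "m \<ge> 0" using m[OF x] norm_ge_zero[of "f x"] by linarith
    have f': "f absolutely_integrable_on {0..a}"
      using f absolutely_integrable_continuous_real by blast
    have intf: "integral {0..a} (\<lambda>t. cmod (f t)) \<le> a * m"
      using integral_bound[of 0 a "\<lambda>t. cmod (f t)" m] f m a
      by (simp add: continuous_on_norm mult.commute)
    have "integral {0..a} (\<lambda>t. cmod (q t - z\<^sup>2)) \<le> integral {0..a} (\<lambda>t. cmod (q t) + R\<^sup>2)"
    proof (rule integral_le)
      fix t
      have "cmod (z\<^sup>2) \<le> R\<^sup>2" using z by (simp add: norm_power power_mono)
      then show "cmod (q t - z\<^sup>2) \<le> cmod (q t) + R\<^sup>2"
        using norm_triangle_ineq4[of "q t" "z\<^sup>2"] by linarith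
    qed (auto intro!: integrable_add absolutely_integrable_cmod q potential_integrable)
    also have "\<dots> = K"
      using a Henstock_Kurzweil_Integration.integral_add[OF absolutely_integrable_cmod[OF q]
          integrable_const_ivl, of "R\<^sup>2"]
      by (simp add: K_def absolutely_integrable_cmod q)
    finally have intp: "integral {0..a} (\<lambda>t. cmod (q t - z\<^sup>2)) \<le> K" .
    have yB: "cmod (y s) \<le> B * m" if s: "s \<in> {0..a}" for s
    proof -
      have "cmod (y s) \<le> 2 * exp (2 * a * integral {0..a} (\<lambda>t. cmod (q t - z\<^sup>2))) *
           (a * integral {0..a} (\<lambda>t. cmod (f t)))"
        using volterra_bound[OF potential_integrable f' y s] by simp
      also have "\<dots> \<le> 2 * exp (2 * a * K) * (a * (a * m))"
        using intp intf a m0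
        by (intro mult_mono mult_left_mono)
           (auto intro!: mult_nonneg_nonneg Henstock_Kurzweil_Integration.integral_nonneg
             absolutely_integrable_cmod f')
      finally show ?thesis by (simp add: B_def power2_eq_square mult_ac)
    qed
    have sub: "{0..x} \<subseteq> {0..a}" using x by auto
    have px: "(\<lambda>t. cmod (q t - z\<^sup>2)) integrable_on {0..x}"
      using absolutely_integrable_on_subinterval[OF potential_integrable sub]
      by (rule absolutely_integrable_cmod)
    have "cmod (v x) \<le> integral {0..x} (\<lambda>t. (B * m) * cmod (q t - z\<^sup>2) + m)"
    proof -
      have "v x = integral {0..x} (\<lambda>t. (q t - z\<^sup>2) * y t + f t)"
        using twice_primitiveD(5)[OF y x] by simp
      also have "cmod \<dots> \<le> integral {0..x} (\<lambda>t. (B * m) * cmod (q t - z\<^sup>2) + m)"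
      proof (rule integral_norm_bound_integral)
        show "(\<lambda>t. (q t - z\<^sup>2) * y t + f t) integrable_on {0..x}"
          using twice_primitiveD(2)[OF y] sub by (rule integrable_on_subinterval)
        show "(\<lambda>t. (B * m) * cmod (q t - z\<^sup>2) + m) integrable_on {0..x}"
          by (intro integrable_add integrable_on_mult_right px) auto
        fix t assume "t \<in> {0..x}"
        then have t: "t \<in> {0..a}" using sub by auto
        have "cmod ((q t - z\<^sup>2) * y t) \<le> (B * m) * cmod (q t - z\<^sup>2)"
          using mult_right_mono[OF yB[OF t] norm_ge_zero[of "q t - z\<^sup>2"]] by (simp add: norm_mult mult.commute)
        then show "cmod ((q t - z\<^sup>2) * y t + f t) \<le> (B * m) * cmod (q t - z\<^sup>2) + m"
          using m[OF t] norm_triangle_ineq[of "(q t - z\<^sup>2) * y t" "f t"] by linarith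
      qed
      finally show ?thesis .
    qed
    also have "\<dots> = (B * m) * integral {0..x} (\<lambda>t. cmod (q t - z\<^sup>2)) + x * m"
      using x Henstock_Kurzweil_Integration.integral_add[OF integrable_on_mult_right[OF px]
          integrable_const_ivl, of "B * m" m] by simp
    also have "\<dots> \<le> (B * m) * integral {0..a} (\<lambda>t. cmod (q t - z\<^sup>2)) + a * m"
      using B0 m0 x
      by (intro add_mono mult_left_mono mult_right_mono integral_subset_le sub px
          absolutely_integrable_cmod potential_integrable) auto
    also have "\<dots> \<le> (B * m) * K + a * m"
      using intp B0 m0 by (intro add_right_mono mult_left_mono) auto
    finally have "cmod (v x) \<le> (K * B + a) * m" by (simp add: algebra_simps)
    moreover have "0 \<le> B * m" "0 \<le> (K * B + a) * m" using B0 K0 a m0 by auto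
    ultimately show ?thesis using yB[OF x] by (simp add: algebra_simps)
  qed
  then show ?thesis by blast
qed

text \<open>
  The derivative \<open>w\<close> in the spectral parameter solves the formally differentiated problem. For
  \<open>h = \<mu> - z\<close>, the remainder \<open>Y \<mu> - Y z - h w\<close> solves the equation at \<open>\<mu>\<close> with zero initial data and
  forcing \<open>- h\<^sup>2 (Y z + (2 z + h) w)\<close>, so it is of order \<open>\<bar>h\<bar>\<^sup>2\<close>.
\<close>
lemma Y_has_field_derivative:
  obtains w w' where
    "twice_primitive a (\<lambda>t. (q t - z\<^sup>2) * w t - 2 * z * Y z t) 0 (\<i> * of_real \<alpha>\<^sub>0) w w'"
    "\<And>x. x \<in> {0..a} \<Longrightarrow> ((\<lambda>\<mu>. Y \<mu> x) has_field_derivative w x) (at z)"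
    "\<And>x. x \<in> {0..a} \<Longrightarrow> ((\<lambda>\<mu>. Y' \<mu> x) has_field_derivative w' x) (at z)"
proof -
  have "(\<lambda>t. - (2 * z) * Y z t) absolutely_integrable_on {0..a}"
    by (intro absolutely_integrable_continuous_real continuous_intros Y_continuous)
  from volterra_exists[OF _ potential_integrable this, of z 0 "\<i> * of_real \<alpha>\<^sub>0"] a
  obtain w w' where w: "twice_primitive a (\<lambda>t. (q t - z\<^sup>2) * w t - 2 * z * Y z t) 0 (\<i> * of_real \<alpha>\<^sub>0) w w'"
    by auto
  note w_cont = twice_primitive_continuous(1)[OF w]
  obtain C where C: "\<forall>\<mu> f y v m. cmod \<mu> \<le> cmod z + 1 \<and> continuous_on {0..a} f \<and>
      twice_primitive a (\<lambda>t. (q t - \<mu>\<^sup>2) * y t + f t) 0 0 y v \<and> (\<forall>t\<in>{0..a}. cmod (f t) \<le> m) \<longrightarrow>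
      (\<forall>x\<in>{0..a}. cmod (y x) \<le> C * m \<and> cmod (v x) \<le> C * m)"
    using solution_bound[of "cmod z + 1"] by (elim exE)
  have "bounded (Y z ` {0..a})" "bounded (w ` {0..a})"
    by (intro compact_imp_bounded compact_continuous_image Y_continuous w_cont compact_Icc)+
  then obtain B1 B2 where B1: "\<And>t. t \<in> {0..a} \<Longrightarrow> cmod (Y z t) \<le> B1"
    and B2: "\<And>t. t \<in> {0..a} \<Longrightarrow> cmod (w t) \<le> B2"
    unfolding bounded_iff by blast
  define M where "M = B1 + (2 * cmod z + 1) * B2"
  have key: "cmod (Y \<mu> x - Y z x - (\<mu> - z) * w x) \<le> (C * M) * (cmod (\<mu> - z))\<^sup>2 \<and>
             cmod (Y' \<mu> x - Y' z x - (\<mu> - z) * w' x) \<le> (C * M) * (cmod (\<mu> - z))\<^sup>2"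
    if h: "cmod (\<mu> - z) \<le> 1" and x: "x \<in> {0..a}" for \<mu> x
  proof -
    define h where "h = \<mu> - z"
    have \<mu>: "\<mu> = z + h" by (simp add: h_def)
    have sol: "twice_primitive a
         (\<lambda>t. (q t - \<mu>\<^sup>2) * (Y \<mu> t + (-1) * Y z t + (- h) * w t) + (- h\<^sup>2) * (Y z t + (2 * z + h) * w t)) 0 0
         (\<lambda>x. Y \<mu> x + (-1) * Y z x + (- h) * w x) (\<lambda>x. Y' \<mu> x + (-1) * Y' z x + (- h) * w' x)"
    proof -
      have g: "((q t - \<mu>\<^sup>2) * Y \<mu> t + (-1) * ((q t - z\<^sup>2) * Y z t)) + (- h) * ((q t - z\<^sup>2) * w t - 2 * z * Y z t) =
        (q t - \<mu>\<^sup>2) * (Y \<mu> t + (-1) * Y z t + (- h) * w t) + (- h\<^sup>2) * (Y z t + (2 * z + h) * w t)" for t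
        unfolding \<mu> by algebra
      have cd: "1 + (-1) * 1 + (- h) * 0 = (0 :: complex)"
        "(\<i> * of_real \<alpha>\<^sub>0 * \<mu> + \<beta>\<^sub>0) + (-1) * (\<i> * of_real \<alpha>\<^sub>0 * z + \<beta>\<^sub>0) + (- h) * (\<i> * of_real \<alpha>\<^sub>0) = 0"
        unfolding \<mu> by algebra+
      show ?thesis
        using twice_primitive_lincomb[OF
            twice_primitive_lincomb[OF Y_solves[of \<mu>] Y_solves[of z], of "-1"] w, of "- h"]
        unfolding g cd .
    qed
    have "cmod ((- h\<^sup>2) * (Y z t + (2 * z + h) * w t)) \<le> (cmod h)\<^sup>2 * M" if t: "t \<in> {0..a}" for t
    proof -
      have "cmod (2 * z + h) \<le> 2 * cmod z + 1"
        using norm_triangle_ineq[of "2 * z" h] h by (simp add: h_def norm_mult)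
      then have "cmod ((2 * z + h) * w t) \<le> (2 * cmod z + 1) * B2"
        using B2[OF t] by (auto simp: norm_mult intro!: mult_mono)
      then have "cmod (Y z t + (2 * z + h) * w t) \<le> M"
        unfolding M_def using B1[OF t] norm_triangle_ineq[of "Y z t" "(2 * z + h) * w t"] by linarith
      then show ?thesis by (simp add: norm_mult norm_power mult_left_mono)
    qed
    moreover have "cmod \<mu> \<le> cmod z + 1"
      using h norm_triangle_sub[of \<mu> z] by linarith
    moreover have "continuous_on {0..a} (\<lambda>t. (- h\<^sup>2) * (Y z t + (2 * z + h) * w t))"
      by (intro continuous_intros Y_continuous w_cont)
    ultimately have "cmod (Y \<mu> x + (-1) * Y z x + (- h) * w x) \<le> C * ((cmod h)\<^sup>2 * M) \<and>
        cmod (Y' \<mu> x + (-1) * Y' z x + (- h) * w' x) \<le> C * ((cmod h)\<^sup>2 * M)"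
      using C[rule_format, OF conjI[OF _ conjI[OF _ conjI[OF sol]]]] x by blast
    then show ?thesis by (simp add: h_def algebra_simps)
  qed
  show thesis
  proof (rule that[OF w])
    fix x assume x: "x \<in> {0..a}"
    show "((\<lambda>\<mu>. Y \<mu> x) has_field_derivative w x) (at z)"
      "((\<lambda>\<mu>. Y' \<mu> x) has_field_derivative w' x) (at z)"
      using key x by (auto intro!: has_field_derivative_if_quadratic_bound[where C = "C * M"])
  qed
qed

text \<open>
  Green's identity for \<open>Y z\<close> and its derivative in \<open>z\<close>; the potential cancels and only the forcing
  term \<open>- 2 z Y\<close> survives under the integral. The characteristic function then contributes
  \<open>i \<alpha> Y(a)\<^sup>2\<close>, since its coefficient \<open>i \<alpha> z + \<beta>\<close> depends on \<open>z\<close>.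
\<close>
lemma Delta0_Delta_derivatives:
  obtains D0 D where
    "(Delta0 a q \<alpha>\<^sub>0 \<beta>\<^sub>0 has_field_derivative D0) (at z)"
    "(Delta a q \<alpha>\<^sub>0 \<beta>\<^sub>0 \<alpha> \<beta> has_field_derivative D) (at z)"
    "Delta0 a q \<alpha>\<^sub>0 \<beta>\<^sub>0 z * D - D0 * Delta a q \<alpha>\<^sub>0 \<beta>\<^sub>0 \<alpha> \<beta> z =
       \<i> * of_real \<alpha>\<^sub>0 - 2 * z * integral {0..a} (\<lambda>t. (Y z t)\<^sup>2) + \<i> * of_real \<alpha> * (Delta0 a q \<alpha>\<^sub>0 \<beta>\<^sub>0 z)\<^sup>2"
proof -
  obtain w w' where w: "twice_primitive a (\<lambda>t. (q t - z\<^sup>2) * w t - 2 * z * Y z t) 0 (\<i> * of_real \<alpha>\<^sub>0) w w'"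
    and "\<And>x. x \<in> {0..a} \<Longrightarrow> ((\<lambda>\<mu>. Y \<mu> x) has_field_derivative w x) (at z)"
    and "\<And>x. x \<in> {0..a} \<Longrightarrow> ((\<lambda>\<mu>. Y' \<mu> x) has_field_derivative w' x) (at z)"
    using Y_has_field_derivative by blast
  then have dY: "((\<lambda>\<mu>. Y \<mu> a) has_field_derivative w a) (at z)"
    and dY': "((\<lambda>\<mu>. Y' \<mu> a) has_field_derivative w' a) (at z)"
    using a by auto
  have "Y z a * w' a - Y' z a * w a - \<i> * of_real \<alpha>\<^sub>0 =
        integral {0..a} (\<lambda>t. Y z t * ((q t - z\<^sup>2) * w t - 2 * z * Y z t) - ((q t - z\<^sup>2) * Y z t) * w t)"
    using green_identity[OF w Y_solves[of z], of a] a by simp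
  also have "\<dots> = integral {0..a} (\<lambda>t. (- 2 * z) * (Y z t)\<^sup>2)"
    by (rule arg_cong[where f = "integral _"]) (auto simp: algebra_simps power2_eq_square)
  also have "\<dots> = - 2 * z * integral {0..a} (\<lambda>t. (Y z t)\<^sup>2)"
    by simp
  finally have id: "Y z a * w' a - Y' z a * w a = \<i> * of_real \<alpha>\<^sub>0 - 2 * z * integral {0..a} (\<lambda>t. (Y z t)\<^sup>2)"
    by (simp add: algebra_simps)
  show thesis
  proof (rule that[of "w a" "w' a + \<i> * of_real \<alpha> * Y z a + (\<i> * of_real \<alpha> * z + \<beta>) * w a"])
    show "(Delta0 a q \<alpha>\<^sub>0 \<beta>\<^sub>0 has_field_derivative w a) (at z)"
      using dY by (simp add: Delta0_def[abs_def])
    show "(Delta a q \<alpha>\<^sub>0 \<beta>\<^sub>0 \<alpha> \<beta> has_field_derivative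
            w' a + \<i> * of_real \<alpha> * Y z a + (\<i> * of_real \<alpha> * z + \<beta>) * w a) (at z)"
      unfolding Delta_def[abs_def] by (auto intro!: derivative_eq_intros dY dY')
    show "Delta0 a q \<alpha>\<^sub>0 \<beta>\<^sub>0 z * (w' a + \<i> * of_real \<alpha> * Y z a + (\<i> * of_real \<alpha> * z + \<beta>) * w a) -
        w a * Delta a q \<alpha>\<^sub>0 \<beta>\<^sub>0 \<alpha> \<beta> z =
       \<i> * of_real \<alpha>\<^sub>0 - 2 * z * integral {0..a} (\<lambda>t. (Y z t)\<^sup>2) + \<i> * of_real \<alpha> * (Delta0 a q \<alpha>\<^sub>0 \<beta>\<^sub>0 z)\<^sup>2"
      unfolding id[symmetric] Delta0_def Delta_def by (simp add: algebra_simps power2_eq_square)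
  qed
qed

text \<open>
  A second solution with initial values \<open>0\<close> and \<open>1\<close> has Wronskian \<open>-1\<close> with \<open>Y z\<close> at \<open>0\<close>,
  hence also at \<open>a\<close>, where it would vanish.
\<close>
lemma solution_no_double_zero: "Y z a = 0 \<Longrightarrow> Y' z a \<noteq> 0"
proof
  assume 0: "Y z a = 0" "Y' z a = 0"
  obtain u w where u: "twice_primitive a (\<lambda>t. (q t - z\<^sup>2) * u t + 0) 0 1 u w"
    by (rule volterra_exists[OF less_imp_le[OF a] potential_integrable]) auto
  have "integral {0..a} (\<lambda>t. u t * ((q t - z\<^sup>2) * Y z t) - ((q t - z\<^sup>2) * u t + 0) * Y z t) =
        (u a * Y' z a - w a * Y z a) + 1"
    using green_identity[OF Y_solves[of z] u, of a] a by simp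
  moreover have "(\<lambda>t. u t * ((q t - z\<^sup>2) * Y z t) - ((q t - z\<^sup>2) * u t + 0) * Y z t) = (\<lambda>_. 0)"
    by (auto simp: fun_eq_iff)
  ultimately show False using 0 by simp
qed

end

section \<open>Exponential asymptotics of the characteristic function\<close>

lemma norm_sin_cos_le:
  fixes z :: complex
  shows "cmod (sin z) \<le> exp \<bar>Im z\<bar>" "cmod (cos z) \<le> exp \<bar>Im z\<bar>"
proof -
  have e: "cmod (exp (\<i> * z)) \<le> exp \<bar>Im z\<bar>" "cmod (exp (- (\<i> * z))) \<le> exp \<bar>Im z\<bar>"
    unfolding norm_exp_eq_Re exp_le_cancel_iff by auto
  from order_trans[OF norm_triangle_ineq4 add_mono[OF e]]
  show "cmod (sin z) \<le> exp \<bar>Im z\<bar>" by (simp add: sin_exp_eq norm_divide norm_mult)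
  from order_trans[OF norm_triangle_ineq add_mono[OF e]]
  show "cmod (cos z) \<le> exp \<bar>Im z\<bar>" by (simp add: cos_exp_eq norm_divide)
qed

lemma twice_primitive_of_C2:
  fixes u u' u'' :: "complex \<Rightarrow> complex"
  assumes "\<And>t. (u has_field_derivative u' t) (at t)" "\<And>t. (u' has_field_derivative u'' t) (at t)"
    and "continuous_on UNIV u''"
  shows "twice_primitive a (\<lambda>t. u'' (of_real t)) (u 0) (u' 0) (\<lambda>t. u (of_real t)) (\<lambda>t. u' (of_real t))"
proof -
  have c: "continuous_on S (\<lambda>t::real. u'' (of_real t))" for S
    by (rule continuous_on_compose2[OF assms(3)]) (auto intro!: continuous_intros)
  have "((\<lambda>t. u'' (of_real t)) has_integral (u' (of_real x) - u' (of_real 0))) {0..x}" if "0 \<le> x" for x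
    using that by (intro fundamental_theorem_of_calculus has_vector_derivative_real_field assms(2))
  then have "u' (of_real x) = u' 0 + integral {0..x} (\<lambda>t. u'' (of_real t))" if "x \<in> {0..a}" for x
    using that integral_unique[of "\<lambda>t. u'' (complex_of_real t)" _ "{0..x}"] by fastforce
  then show ?thesis
    unfolding twice_primitive_def using c
    by (intro conjI ballI absolutely_integrable_continuous_real has_vector_derivative_real_field assms(1))
       simp_all
qed

context sturm_liouville
begin

text \<open>
  Green's identity on \<open>[0, x]\<close> against the solutions \<open>sin (z (x - t)) / z\<close> and \<open>cos (z (x - t))\<close> of
  the equation without potential. Their values at \<open>t = x\<close> isolate \<open>Y z x\<close> and \<open>Y' z x\<close>.
\<close>
lemma variation_of_constants:
  assumes z: "z \<noteq> 0" and x: "x \<in> {0..a}"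
  shows "Y z x = cos (z * x) + (\<i> * of_real \<alpha>\<^sub>0 * z + \<beta>\<^sub>0) / z * sin (z * x) +
           integral {0..x} (\<lambda>t. sin (z * of_real (x - t)) / z * q t * Y z t)"
    and "Y' z x = (\<i> * of_real \<alpha>\<^sub>0 * z + \<beta>\<^sub>0) * cos (z * x) - z * sin (z * x) +
           integral {0..x} (\<lambda>t. cos (z * of_real (x - t)) * q t * Y z t)"
proof -
  let ?x = "complex_of_real x"
  have S: "twice_primitive a (\<lambda>t. - z * sin (z * (?x - of_real t))) (sin (z * (?x - 0)) / z) (- cos (z * (?x - 0)))
          (\<lambda>t. sin (z * (?x - of_real t)) / z) (\<lambda>t. - cos (z * (?x - of_real t)))"
    using z by (intro twice_primitive_of_C2[of "\<lambda>t. sin (z * (?x - t)) / z" "\<lambda>t. - cos (z * (?x - t))"])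
       (auto intro!: derivative_eq_intros continuous_intros)
  have C: "twice_primitive a (\<lambda>t. - z\<^sup>2 * cos (z * (?x - of_real t))) (cos (z * (?x - 0))) (z * sin (z * (?x - 0)))
          (\<lambda>t. cos (z * (?x - of_real t))) (\<lambda>t. z * sin (z * (?x - of_real t)))"
    using z by (intro twice_primitive_of_C2[of "\<lambda>t. cos (z * (?x - t))" "\<lambda>t. z * sin (z * (?x - t))"])
       (auto intro!: derivative_eq_intros continuous_intros simp: power2_eq_square)
  have 1: "sin (z * (?x - of_real t)) / z * ((q t - z\<^sup>2) * Y z t) -
      (- z * sin (z * (?x - of_real t))) * Y z t = sin (z * of_real (x - t)) / z * q t * Y z t" for t
    using z by (simp add: field_simps power2_eq_square)
  show "Y z x = cos (z * x) + (\<i> * of_real \<alpha>\<^sub>0 * z + \<beta>\<^sub>0) / z * sin (z * x) +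
           integral {0..x} (\<lambda>t. sin (z * of_real (x - t)) / z * q t * Y z t)"
    unfolding green_identity[OF Y_solves[of z] S x, unfolded 1] using z by (simp add: field_simps)
  have 2: "cos (z * (?x - of_real t)) * ((q t - z\<^sup>2) * Y z t) -
      (- z\<^sup>2 * cos (z * (?x - of_real t))) * Y z t = cos (z * of_real (x - t)) * q t * Y z t" for t
    by (simp add: algebra_simps)
  show "Y' z x = (\<i> * of_real \<alpha>\<^sub>0 * z + \<beta>\<^sub>0) * cos (z * x) - z * sin (z * x) +
           integral {0..x} (\<lambda>t. cos (z * of_real (x - t)) * q t * Y z t)"
    unfolding green_identity[OF Y_solves[of z] C x, unfolded 2] by (simp add: algebra_simps)
qed

text \<open>
  The exponential weights of kernel and solution multiply to \<open>exp (\<sigma> x)\<close> independently of \<open>t\<close>, so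
  the potential enters only through its \<open>L\<^sup>1\<close> norm.
\<close>
lemma convolution_bound:
  fixes k y :: "real \<Rightarrow> complex"
  assumes k: "\<And>t. t \<in> {0..x} \<Longrightarrow> cmod (k t) \<le> c * exp (\<sigma> * (x - t))" "continuous_on {0..x} k"
    and y: "\<And>t. t \<in> {0..x} \<Longrightarrow> cmod (y t) \<le> m * exp (\<sigma> * t)" "continuous_on {0..x} y"
    and x: "x \<in> {0..a}" and c: "c \<ge> 0" and m: "m \<ge> 0"
  shows "cmod (integral {0..x} (\<lambda>t. k t * q t * y t)) \<le>
           c * m * integral {0..a} (\<lambda>t. cmod (q t)) * exp (\<sigma> * x)"
proof -
  have sub: "{0..x} \<subseteq> {0..a}" using x by auto
  have qx: "q absolutely_integrable_on {0..x}"
    using absolutely_integrable_on_subinterval[OF q sub] .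
  have "cmod (integral {0..x} (\<lambda>t. k t * q t * y t)) \<le>
      (c * m * exp (\<sigma> * x)) * integral {0..x} (\<lambda>t. cmod (q t))"
  proof (rule norm_integral_le_mult[OF _ qx])
    have "(\<lambda>t. (k t * y t) * q t) absolutely_integrable_on {0..x}"
      by (intro absolutely_integrable_continuous_mult continuous_intros k y qx)
    then show "(\<lambda>t. k t * q t * y t) integrable_on {0..x}"
      by (simp add: absolutely_integrable_on_def mult_ac)
    fix t assume t: "t \<in> {0..x}"
    have "cmod (k t) * cmod (y t) \<le> (c * exp (\<sigma> * (x - t))) * (m * exp (\<sigma> * t))"
      using k(1)[OF t] y(1)[OF t] c by (intro mult_mono) auto
    also have "\<dots> = c * m * exp (\<sigma> * x)"
      by (simp add: algebra_simps flip: exp_add)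
    finally show "cmod (k t * q t * y t) \<le> c * m * exp (\<sigma> * x) * cmod (q t)"
      using mult_right_mono[of "cmod (k t) * cmod (y t)" "c * m * exp (\<sigma> * x)" "cmod (q t)"]
      by (simp add: norm_mult mult_ac)
  qed
  also have "\<dots> \<le> (c * m * exp (\<sigma> * x)) * integral {0..a} (\<lambda>t. cmod (q t))"
    using c m by (intro mult_left_mono integral_subset_le sub absolutely_integrable_cmod q qx) auto
  finally show ?thesis by (simp add: mult_ac)
qed

text \<open>
  For \<open>\<bar>z\<bar> \<ge> 2 \<integral>\<bar>q\<bar>\<close> the integral term in the variation of constants formula is at most half the
  maximum \<open>m\<close> of \<open>\<bar>Y z x\<bar> exp (- \<bar>Im z\<bar> x)\<close> and is absorbed on the left. The summand \<open>1\<close> in the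
  hypothesis keeps \<open>\<beta>\<^sub>0 / z\<close> bounded by \<open>\<bar>\<beta>\<^sub>0\<bar>\<close>.
\<close>
lemma Y_exponential_bound:
  assumes z: "cmod z \<ge> 1 + 2 * integral {0..a} (\<lambda>t. cmod (q t))" and x: "x \<in> {0..a}"
  shows "cmod (Y z x) \<le> 2 * (1 + \<bar>\<alpha>\<^sub>0\<bar> + cmod \<beta>\<^sub>0) * exp (\<bar>Im z\<bar> * x)"
proof -
  define Q where "Q = integral {0..a} (\<lambda>t. cmod (q t))"
  define \<sigma> where "\<sigma> = \<bar>Im z\<bar>"
  define A where "A = 1 + \<bar>\<alpha>\<^sub>0\<bar> + cmod \<beta>\<^sub>0"
  have Q: "Q \<ge> 0"
    unfolding Q_def by (intro Henstock_Kurzweil_Integration.integral_nonneg absolutely_integrable_cmod q) auto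
  have z1: "cmod z \<ge> 1" "z \<noteq> 0" "2 * Q \<le> cmod z" using z Q by (auto simp: Q_def[symmetric])
  have trig: "cmod (sin (z * of_real s)) \<le> exp (\<sigma> * s)" "cmod (cos (z * of_real s)) \<le> exp (\<sigma> * s)"
    if "s \<ge> 0" for s
    using norm_sin_cos_le[of "z * of_real s"] that by (simp_all add: \<sigma>_def abs_mult)
  have "continuous_on {0..a} (\<lambda>t. cmod (Y z t) * exp (- \<sigma> * t))"
    by (intro continuous_intros Y_continuous)
  with continuous_attains_sup[of "{0..a}" "\<lambda>t. cmod (Y z t) * exp (- \<sigma> * t)"] a
  obtain x0 where x0: "x0 \<in> {0..a}"
    and "\<And>t. t \<in> {0..a} \<Longrightarrow> cmod (Y z t) * exp (- \<sigma> * t) \<le> cmod (Y z x0) * exp (- \<sigma> * x0)"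
    by fastforce
  moreover define m where "m = cmod (Y z x0) * exp (- \<sigma> * x0)"
  ultimately have "cmod (Y z t) * exp (- \<sigma> * t) \<le> m" if "t \<in> {0..a}" for t
    using that by simp
  then have m: "cmod (Y z t) \<le> m * exp (\<sigma> * t)" if "t \<in> {0..a}" for t
    using mult_right_mono[of "cmod (Y z t) * exp (- \<sigma> * t)" m "exp (\<sigma> * t)"] that
    by (simp add: mult.assoc flip: exp_add)
  have m0: "m \<ge> 0" by (simp add: m_def)
  have d: "cmod ((\<i> * of_real \<alpha>\<^sub>0 * z + \<beta>\<^sub>0) / z) \<le> \<bar>\<alpha>\<^sub>0\<bar> + cmod \<beta>\<^sub>0"
  proof -
    have "(\<i> * of_real \<alpha>\<^sub>0 * z + \<beta>\<^sub>0) / z = \<i> * of_real \<alpha>\<^sub>0 + \<beta>\<^sub>0 / z"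
      using z1 by (simp add: field_simps)
    moreover have "cmod \<beta>\<^sub>0 / cmod z \<le> cmod \<beta>\<^sub>0"
      using z1 by (simp add: divide_le_eq mult_le_cancel_left1)
    ultimately show ?thesis
      using norm_triangle_ineq[of "\<i> * of_real \<alpha>\<^sub>0" "\<beta>\<^sub>0 / z"] by (simp add: norm_mult norm_divide)
  qed
  have "m * exp (\<sigma> * x0) = cmod (Y z x0)" by (simp add: m_def flip: exp_add mult.assoc)
  also have "\<dots> \<le> cmod (cos (z * x0)) + cmod ((\<i> * of_real \<alpha>\<^sub>0 * z + \<beta>\<^sub>0) / z * sin (z * x0)) +
       cmod (integral {0..x0} (\<lambda>t. sin (z * of_real (x0 - t)) / z * q t * Y z t))"
    unfolding variation_of_constants(1)[OF z1(2) x0]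
    by (intro order_trans[OF norm_triangle_ineq] add_mono norm_triangle_ineq) auto
  also have "\<dots> \<le> exp (\<sigma> * x0) + (\<bar>\<alpha>\<^sub>0\<bar> + cmod \<beta>\<^sub>0) * exp (\<sigma> * x0) + (1 / cmod z) * m * Q * exp (\<sigma> * x0)"
  proof (intro add_mono)
    show "cmod (cos (z * x0)) \<le> exp (\<sigma> * x0)" using trig x0 by auto
    show "cmod ((\<i> * of_real \<alpha>\<^sub>0 * z + \<beta>\<^sub>0) / z * sin (z * x0)) \<le> (\<bar>\<alpha>\<^sub>0\<bar> + cmod \<beta>\<^sub>0) * exp (\<sigma> * x0)"
      unfolding norm_mult[of "_ / _"] using d trig x0 by (intro mult_mono) auto
    show "cmod (integral {0..x0} (\<lambda>t. sin (z * of_real (x0 - t)) / z * q t * Y z t)) \<le>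
            (1 / cmod z) * m * Q * exp (\<sigma> * x0)"
      unfolding Q_def
    proof (rule convolution_bound)
      fix t assume t: "t \<in> {0..x0}"
      show "cmod (sin (z * of_real (x0 - t)) / z) \<le> 1 / cmod z * exp (\<sigma> * (x0 - t))"
        using trig(1)[of "x0 - t"] t z1 by (simp add: norm_divide divide_right_mono)
      show "cmod (Y z t) \<le> m * exp (\<sigma> * t)" using m t x0 by auto
    next
      show "continuous_on {0..x0} (Y z)" using Y_continuous by (rule continuous_on_subset) (use x0 in auto)
      show "continuous_on {0..x0} (\<lambda>t. sin (z * of_real (x0 - t)) / z)"
        using z1 by (intro continuous_intros) auto
    qed (use x0 m0 in auto)
  qed
  also have "\<dots> = (A + m * (Q / cmod z)) * exp (\<sigma> * x0)"
    by (simp add: A_def field_simps)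
  finally have "m \<le> A + m * (Q / cmod z)" by simp
  also have "m * (Q / cmod z) \<le> m * (1 / 2)"
    using z1 m0 by (intro mult_left_mono) (auto simp: divide_le_eq)
  finally have "m \<le> 2 * A" by simp
  then have "m * exp (\<sigma> * x) \<le> 2 * A * exp (\<sigma> * x)" by (intro mult_right_mono) auto
  with m[OF x] have "cmod (Y z x) \<le> 2 * A * exp (\<sigma> * x)" by (rule order_trans)
  then show ?thesis unfolding A_def \<sigma>_def .
qed

text \<open>
  Inserting the exponential bound into the variation of constants formula leaves an error of order
  \<open>exp (\<bar>Im z\<bar> a)\<close>, while the leading term carries an extra factor \<open>z\<close>. Written in
  exponentials, \<open>- z (1 + \<alpha> \<alpha>\<^sub>0) sin (z a) + i z (\<alpha> + \<alpha>\<^sub>0) cos (z a)\<close> has the factorised coefficients \<open>A\<close>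
  and \<open>B\<close>.
\<close>
lemma Delta_asymptotics:
  defines "A \<equiv> \<lambda>\<alpha>. (1 + \<alpha>) * (1 + \<alpha>\<^sub>0)" and "B \<equiv> \<lambda>\<alpha>. (1 - \<alpha>) * (1 - \<alpha>\<^sub>0)"
  obtains C R where
    "\<forall>z. R \<le> cmod z \<longrightarrow> cmod (Delta a q \<alpha>\<^sub>0 \<beta>\<^sub>0 \<alpha> \<beta> z -
        \<i> * z / 2 * (of_real (A \<alpha>) * exp (\<i> * z * of_real a) - of_real (B \<alpha>) * exp (- (\<i> * z * of_real a))))
      \<le> C * exp (\<bar>Im z\<bar> * a)"
proof -
  define Q where "Q = integral {0..a} (\<lambda>t. cmod (q t))"
  define M where "M = 2 * (1 + \<bar>\<alpha>\<^sub>0\<bar> + cmod \<beta>\<^sub>0)"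
  define C where "C = (\<bar>\<alpha>\<bar> * cmod \<beta>\<^sub>0 + cmod \<beta> * \<bar>\<alpha>\<^sub>0\<bar> + cmod \<beta> * cmod \<beta>\<^sub>0) + (cmod \<beta>\<^sub>0 + cmod \<beta>) +
      M * Q + (\<bar>\<alpha>\<bar> + cmod \<beta>) * (M * Q)"
  have Q: "Q \<ge> 0"
    unfolding Q_def by (intro Henstock_Kurzweil_Integration.integral_nonneg absolutely_integrable_cmod q) auto
  have M: "M \<ge> 0" by (simp add: M_def)
  show thesis
  proof (rule that[of "1 + 2 * Q"], intro allI impI)
    fix z assume z: "1 + 2 * Q \<le> cmod z"
    then have z1: "cmod z \<ge> 1" "z \<noteq> 0" using Q by auto
    define s where "s = sin (z * of_real a)"
    define c where "c = cos (z * of_real a)"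
    define E where "E = exp (\<bar>Im z\<bar> * a)"
    define I1 where "I1 = integral {0..a} (\<lambda>t. sin (z * of_real (a - t)) * q t * Y z t)"
    define I2 where "I2 = integral {0..a} (\<lambda>t. cos (z * of_real (a - t)) * q t * Y z t)"
    have trig: "cmod (sin (z * of_real s)) \<le> 1 * exp (\<bar>Im z\<bar> * s)"
      "cmod (cos (z * of_real s)) \<le> 1 * exp (\<bar>Im z\<bar> * s)" if "s \<ge> 0" for s
      using norm_sin_cos_le[of "z * of_real s"] that by (simp_all add: abs_mult)
    have E: "cmod s \<le> E" "cmod c \<le> E" using trig[of a] a by (simp_all add: s_def c_def E_def)
    have Yb: "cmod (Y z t) \<le> M * exp (\<bar>Im z\<bar> * t)" if "t \<in> {0..a}" for t
      using Y_exponential_bound[of z t] that z by (simp add: Q_def M_def)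
    have "cmod (sin (z * of_real (a - t))) \<le> 1 * exp (\<bar>Im z\<bar> * (a - t))"
      "cmod (cos (z * of_real (a - t))) \<le> 1 * exp (\<bar>Im z\<bar> * (a - t))" if "t \<in> {0..a}" for t
      using that trig[of "a - t"] by (auto simp del: of_real_diff)
    note trig' = this
    have conv: "cmod (integral {0..a} (\<lambda>t. k t * q t * Y z t)) \<le> 1 * M * Q * exp (\<bar>Im z\<bar> * a)"
      if "\<And>t. t \<in> {0..a} \<Longrightarrow> cmod (k t) \<le> 1 * exp (\<bar>Im z\<bar> * (a - t))" "continuous_on {0..a} k" for k
      unfolding Q_def using a M by (intro convolution_bound that Yb Y_continuous) auto
    have "cmod I1 \<le> 1 * M * Q * exp (\<bar>Im z\<bar> * a)"
      unfolding I1_def by (intro conv trig' continuous_intros)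
    moreover have "cmod I2 \<le> 1 * M * Q * exp (\<bar>Im z\<bar> * a)"
      unfolding I2_def by (intro conv trig' continuous_intros)
    ultimately have I: "cmod I1 \<le> M * Q * E" "cmod I2 \<le> M * Q * E" by (simp_all add: E_def)
    have "integral {0..a} (\<lambda>t. sin (z * of_real (a - t)) / z * q t * Y z t) =
          integral {0..a} (\<lambda>t. (1 / z) * (sin (z * of_real (a - t)) * q t * Y z t))"
      by (intro arg_cong[where f = "integral _"]) (auto simp: field_simps)
    also have "\<dots> = 1 / z * I1" unfolding I1_def by simp
    finally have eq: "Y z a = c + (\<i> * of_real \<alpha>\<^sub>0 * z + \<beta>\<^sub>0) / z * s + 1 / z * I1"
        "Y' z a = (\<i> * of_real \<alpha>\<^sub>0 * z + \<beta>\<^sub>0) * c - z * s + I2"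
      using variation_of_constants[OF z1(2), of a] a
      by (simp_all add: s_def c_def I2_def)
    have main: "\<i> * z / 2 * (of_real (A \<alpha>) * exp (\<i> * z * of_real a) - of_real (B \<alpha>) * exp (- (\<i> * z * of_real a))) =
        z * (\<i> * of_real (\<alpha>\<^sub>0 + \<alpha>) * c - of_real (1 + \<alpha> * \<alpha>\<^sub>0) * s)"
    proof -
      have c: "exp (\<i> * z * of_real a) = c + \<i> * s"
        unfolding c_def s_def by (metis exp_Euler mult.assoc)
      have c': "exp (- (\<i> * z * of_real a)) = c - \<i> * s"
        unfolding c_def s_def using exp_Euler[of "- (z * of_real a)"] by (simp add: mult.assoc)
      show ?thesis unfolding c c' A_def B_def by (simp add: field_simps)
    qed
    have "Delta a q \<alpha>\<^sub>0 \<beta>\<^sub>0 \<alpha> \<beta> z - z * (\<i> * of_real (\<alpha>\<^sub>0 + \<alpha>) * c - of_real (1 + \<alpha> * \<alpha>\<^sub>0) * s) =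
       (\<i> * of_real \<alpha> * \<beta>\<^sub>0 + \<i> * \<beta> * of_real \<alpha>\<^sub>0 + \<beta> * \<beta>\<^sub>0 / z) * s + (\<beta>\<^sub>0 + \<beta>) * c + I2 +
       (\<i> * of_real \<alpha> + \<beta> / z) * I1"
      unfolding Delta_def eq using z1 by (simp add: field_simps)
    also have "cmod \<dots> \<le> (\<bar>\<alpha>\<bar> * cmod \<beta>\<^sub>0 + cmod \<beta> * \<bar>\<alpha>\<^sub>0\<bar> + cmod \<beta> * cmod \<beta>\<^sub>0) * E +
        (cmod \<beta>\<^sub>0 + cmod \<beta>) * E + M * Q * E + (\<bar>\<alpha>\<bar> + cmod \<beta>) * (M * Q * E)"
    proof -
      have div: "cmod (w / z) \<le> cmod w" for w
        using z1 by (simp add: norm_divide divide_le_eq mult_le_cancel_left1)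
      have t1: "cmod (\<i> * of_real \<alpha> * \<beta>\<^sub>0 + \<i> * \<beta> * of_real \<alpha>\<^sub>0 + \<beta> * \<beta>\<^sub>0 / z) \<le>
          \<bar>\<alpha>\<bar> * cmod \<beta>\<^sub>0 + cmod \<beta> * \<bar>\<alpha>\<^sub>0\<bar> + cmod \<beta> * cmod \<beta>\<^sub>0"
        by (intro order_trans[OF norm_triangle_ineq] add_mono order_trans[OF div]) (auto simp: norm_mult)
      have t2: "cmod (\<i> * of_real \<alpha> + \<beta> / z) \<le> \<bar>\<alpha>\<bar> + cmod \<beta>"
        by (intro order_trans[OF norm_triangle_ineq] add_mono order_trans[OF div]) (auto simp: norm_mult)
      show ?thesis
        by (intro order_trans[OF norm_triangle_ineq] add_mono)
           (auto simp only: norm_mult intro!: mult_mono t1 t2 E I norm_triangle_ineq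
            add_nonneg_nonneg mult_nonneg_nonneg norm_ge_zero abs_ge_zero)
    qed
    also have "\<dots> = C * E" by (simp add: C_def algebra_simps)
    finally show "cmod (Delta a q \<alpha>\<^sub>0 \<beta>\<^sub>0 \<alpha> \<beta> z -
        \<i> * z / 2 * (of_real (A \<alpha>) * exp (\<i> * z * of_real a) - of_real (B \<alpha>) * exp (- (\<i> * z * of_real a))))
      \<le> C * exp (\<bar>Im z\<bar> * a)"
      unfolding main E_def .
  qed
qed

end

section \<open>Half-planes with finitely many eigenvalues\<close>

lemma entire_finite_zeros:
  fixes f :: "complex \<Rightarrow> complex"
  assumes f: "f holomorphic_on UNIV"
    and S: "\<And>z. z \<in> S \<Longrightarrow> R \<le> cmod z \<Longrightarrow> f z \<noteq> 0" and w: "f w \<noteq> 0"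
  shows "finite {z. f z = 0 \<and> z \<in> S}"
proof (cases "f constant_on UNIV")
  case True
  then have "f z \<noteq> 0" for z using w by (auto simp: constant_on_def)
  then show ?thesis by simp
next
  case False
  have "finite {z \<in> cball 0 R. f z = 0}"
    by (rule holomorphic_compact_finite_zeros[OF f _ _ _ _ False]) auto
  moreover have "{z. f z = 0 \<and> z \<in> S} \<subseteq> {z \<in> cball 0 R. f z = 0}"
    using S by force
  ultimately show ?thesis by (rule finite_subset[rotated])
qed

text \<open>
  In the half-plane where the exponential with the larger coefficient is also the growing one, the
  bracket is at least \<open>\<bar>\<bar>A\<bar> - \<bar>B\<bar>\<bar> exp (\<bar>Im z\<bar> a)\<close>, and the factor \<open>z\<close> beats the error.
\<close>
lemma dominant_exponential_nonzero:
  fixes z :: complex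
  assumes F: "cmod (F - \<i> * z / 2 * (of_real A * exp (\<i> * z * of_real a) - of_real B * exp (- (\<i> * z * of_real a))))
      \<le> C * exp (\<bar>Im z\<bar> * a)"
    and dom: "(Im z \<le> 0 \<and> \<bar>B\<bar> < \<bar>A\<bar>) \<or> (0 \<le> Im z \<and> \<bar>A\<bar> < \<bar>B\<bar>)"
    and a: "0 < a" and z: "2 * C < cmod z * \<bar>\<bar>A\<bar> - \<bar>B\<bar>\<bar>"
  shows "F \<noteq> 0"
proof
  assume "F = 0"
  define E where "E = exp (\<bar>Im z\<bar> * a)"
  let ?L = "of_real A * exp (\<i> * z * of_real a) - of_real B * exp (- (\<i> * z * of_real a))"
  have n: "cmod (of_real A * exp (\<i> * z * of_real a)) = \<bar>A\<bar> * exp (- Im z * a)"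
    "cmod (of_real B * exp (- (\<i> * z * of_real a))) = \<bar>B\<bar> * exp (Im z * a)"
    by (simp_all add: norm_mult norm_exp_eq_Re)
  have "\<bar>\<bar>A\<bar> - \<bar>B\<bar>\<bar> * E \<le> cmod ?L"
    using dom
  proof
    assume d: "Im z \<le> 0 \<and> \<bar>B\<bar> < \<bar>A\<bar>"
    then have "Im z * a \<le> \<bar>Im z\<bar> * a" using a by (intro mult_right_mono) auto
    then have "\<bar>B\<bar> * exp (Im z * a) \<le> \<bar>B\<bar> * E"
      unfolding E_def by (intro mult_left_mono) auto
    moreover have "exp (- Im z * a) = E" using d by (simp add: E_def)
    moreover have "cmod (of_real A * exp (\<i> * z * of_real a)) - cmod (of_real B * exp (- (\<i> * z * of_real a))) \<le> cmod ?L"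
      by (rule norm_triangle_ineq2)
    ultimately show ?thesis using d unfolding n by (simp add: algebra_simps)
  next
    assume d: "0 \<le> Im z \<and> \<bar>A\<bar> < \<bar>B\<bar>"
    then have "- Im z * a \<le> \<bar>Im z\<bar> * a" using a by (intro mult_right_mono) auto
    then have "\<bar>A\<bar> * exp (- Im z * a) \<le> \<bar>A\<bar> * E"
      unfolding E_def by (intro mult_left_mono) auto
    moreover have "exp (Im z * a) = E" using d by (simp add: E_def)
    moreover have "cmod (of_real B * exp (- (\<i> * z * of_real a))) - cmod (of_real A * exp (\<i> * z * of_real a)) \<le> cmod ?L"
      by (subst norm_minus_commute) (rule norm_triangle_ineq2)
    ultimately show ?thesis using d unfolding n by (simp add: algebra_simps)
  qed
  then have "cmod z / 2 * (\<bar>\<bar>A\<bar> - \<bar>B\<bar>\<bar> * E) \<le> cmod z / 2 * cmod ?L"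
    by (intro mult_left_mono) auto
  also have "\<dots> = cmod (F - \<i> * z / 2 * ?L)"
    using \<open>F = 0\<close> by (simp add: norm_mult norm_divide)
  also have "\<dots> \<le> C * E" using F by (simp add: E_def)
  finally have "(cmod z * \<bar>\<bar>A\<bar> - \<bar>B\<bar>\<bar>) * E \<le> (2 * C) * E" by simp
  then show False using z by (simp add: E_def)
qed

lemma abs_reflection_less:
  fixes x y :: real
  assumes "0 < x" "0 \<le> y"
  shows "\<bar>(1 - x) * (1 - y)\<bar> < \<bar>(1 + x) * (1 + y)\<bar>"
proof -
  have "\<bar>1 - x\<bar> * \<bar>1 - y\<bar> \<le> \<bar>1 - x\<bar> * (1 + y)" using assms by (intro mult_left_mono) auto
  also have "\<dots> < (1 + x) * (1 + y)" using assms by (intro mult_strict_right_mono) auto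
  finally show ?thesis using assms by (simp add: abs_mult)
qed

context sturm_liouville
begin

lemma Delta_entire: "Delta a q \<alpha>\<^sub>0 \<beta>\<^sub>0 \<alpha> \<beta> holomorphic_on UNIV"
  unfolding holomorphic_on_def
proof
  fix z
  obtain D where "(Delta a q \<alpha>\<^sub>0 \<beta>\<^sub>0 \<alpha> \<beta> has_field_derivative D) (at z)"
    using Delta0_Delta_derivatives by blast
  then show "Delta a q \<alpha>\<^sub>0 \<beta>\<^sub>0 \<alpha> \<beta> field_differentiable at z within UNIV"
    by (auto simp: field_differentiable_def)
qed

text \<open>
  The zeros in the half-plane \<open>H\<close> lie in a bounded set, and an entire function that is not
  identically zero has finitely many zeros there.
\<close>
lemma finite_eigenvalues_half_plane:
  assumes H: "(H = {z. Im z \<le> 0} \<and> \<bar>(1 - \<alpha>) * (1 - \<alpha>\<^sub>0)\<bar> < \<bar>(1 + \<alpha>) * (1 + \<alpha>\<^sub>0)\<bar>) \<or>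
    (H = {z. 0 \<le> Im z} \<and> \<bar>(1 + \<alpha>) * (1 + \<alpha>\<^sub>0)\<bar> < \<bar>(1 - \<alpha>) * (1 - \<alpha>\<^sub>0)\<bar>)"
  shows "finite {z. eigenvalue a q \<alpha>\<^sub>0 \<beta>\<^sub>0 \<alpha> \<beta> z \<and> z \<in> H}"
proof -
  let ?A = "(1 + \<alpha>) * (1 + \<alpha>\<^sub>0)" and ?B = "(1 - \<alpha>) * (1 - \<alpha>\<^sub>0)"
  obtain C R where as: "\<forall>z. R \<le> cmod z \<longrightarrow> cmod (Delta a q \<alpha>\<^sub>0 \<beta>\<^sub>0 \<alpha> \<beta> z -
        \<i> * z / 2 * (of_real ?A * exp (\<i> * z * of_real a) - of_real ?B * exp (- (\<i> * z * of_real a))))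
      \<le> C * exp (\<bar>Im z\<bar> * a)"
    by (rule Delta_asymptotics)
  define \<delta> where "\<delta> = \<bar>\<bar>?A\<bar> - \<bar>?B\<bar>\<bar>"
  have \<delta>: "\<delta> > 0" using H by (auto simp: \<delta>_def)
  define R' where "R' = max R ((2 * \<bar>C\<bar> + 1) / \<delta>)"
  have nz: "Delta a q \<alpha>\<^sub>0 \<beta>\<^sub>0 \<alpha> \<beta> z \<noteq> 0" if z: "z \<in> H" "R' \<le> cmod z" for z
  proof (rule dominant_exponential_nonzero[OF as[rule_format] _ a])
    show "R \<le> cmod z" using z by (simp add: R'_def)
    show "Im z \<le> 0 \<and> \<bar>?B\<bar> < \<bar>?A\<bar> \<or> 0 \<le> Im z \<and> \<bar>?A\<bar> < \<bar>?B\<bar>" using H z by auto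
    have "(2 * \<bar>C\<bar> + 1) / \<delta> \<le> cmod z" using z by (simp add: R'_def)
    then have "2 * \<bar>C\<bar> + 1 \<le> cmod z * \<delta>" using \<delta> by (simp add: divide_le_eq)
    then show "2 * C < cmod z * \<bar>\<bar>?A\<bar> - \<bar>?B\<bar>\<bar>" unfolding \<delta>_def by linarith
  qed
  \<comment> \<open>a real point lies in either half-plane and witnesses that the function is not identically zero\<close>
  have "of_real \<bar>R'\<bar> \<in> H" "R' \<le> cmod (of_real \<bar>R'\<bar>)" using H by auto
  from entire_finite_zeros[OF Delta_entire nz nz[OF this]]
  show ?thesis by (simp add: eigenvalue_def)
qed

text \<open>
  On \<open>z = - i t\<close> the leading term of the asymptotics is
  \<open>(t / 2) (A exp (t a) - B exp (- t a))\<close> with \<open>A > \<bar>B\<bar>\<close>.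
\<close>
lemma Delta_eventually_positive:
  assumes \<alpha>: "0 < \<alpha>" and \<alpha>\<^sub>0: "0 \<le> \<alpha>\<^sub>0"
  shows "eventually (\<lambda>t. 0 < Re (Delta a q \<alpha>\<^sub>0 \<beta>\<^sub>0 \<alpha> \<beta> (- \<i> * of_real t))) at_top"
proof -
  let ?A = "(1 + \<alpha>) * (1 + \<alpha>\<^sub>0)" and ?B = "(1 - \<alpha>) * (1 - \<alpha>\<^sub>0)"
  obtain C R where as: "\<forall>z. R \<le> cmod z \<longrightarrow> cmod (Delta a q \<alpha>\<^sub>0 \<beta>\<^sub>0 \<alpha> \<beta> z -
        \<i> * z / 2 * (of_real ?A * exp (\<i> * z * of_real a) - of_real ?B * exp (- (\<i> * z * of_real a))))
      \<le> C * exp (\<bar>Im z\<bar> * a)"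
    by (rule Delta_asymptotics)
  define \<delta> where "\<delta> = ?A - \<bar>?B\<bar>"
  have \<delta>: "\<delta> > 0" using abs_reflection_less[OF \<alpha> \<alpha>\<^sub>0] \<alpha> \<alpha>\<^sub>0 by (simp add: \<delta>_def abs_mult)
  have "eventually (\<lambda>t. max (max R 0) (2 * C / \<delta>) < t) at_top" by (rule eventually_gt_at_top)
  then show ?thesis
  proof eventually_elim
    case (elim t)
    let ?z = "- \<i> * of_real t" and ?L = "t / 2 * (?A * exp (t * a) - ?B * exp (- (t * a)))"
    have t: "R \<le> t" "0 < t" "2 * C < t * \<delta>" using elim \<delta> by (auto simp: divide_less_eq)
    have L: "\<i> * ?z / 2 * (of_real ?A * exp (\<i> * ?z * of_real a) - of_real ?B * exp (- (\<i> * ?z * of_real a))) =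
        of_real ?L"
      by (simp add: exp_of_real flip: of_real_mult of_real_minus of_real_diff)
    have "cmod (Delta a q \<alpha>\<^sub>0 \<beta>\<^sub>0 \<alpha> \<beta> ?z - of_real ?L) \<le> C * exp (\<bar>Im ?z\<bar> * a)"
      unfolding L[symmetric] by (rule as[rule_format]) (use t in \<open>simp add: norm_mult\<close>)
    then have "\<bar>Re (Delta a q \<alpha>\<^sub>0 \<beta>\<^sub>0 \<alpha> \<beta> ?z - of_real ?L)\<bar> \<le> C * exp (t * a)"
      using t abs_Re_le_cmod[of "Delta a q \<alpha>\<^sub>0 \<beta>\<^sub>0 \<alpha> \<beta> ?z - of_real ?L"] by simp
    then have "?L - C * exp (t * a) \<le> Re (Delta a q \<alpha>\<^sub>0 \<beta>\<^sub>0 \<alpha> \<beta> ?z)"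
      by (simp only: minus_complex.simps Re_complex_of_real)
    moreover have "C * exp (t * a) < ?L"
    proof -
      have "exp (- (t * a)) \<le> exp (t * a)" using t a by simp
      then have "\<bar>?B\<bar> * exp (- (t * a)) \<le> \<bar>?B\<bar> * exp (t * a)" by (intro mult_left_mono) auto
      moreover have "?B * exp (- (t * a)) \<le> \<bar>?B\<bar> * exp (- (t * a))" by (intro mult_right_mono) auto
      ultimately have "\<delta> * exp (t * a) \<le> ?A * exp (t * a) - ?B * exp (- (t * a))"
        unfolding \<delta>_def left_diff_distrib by linarith
      then have "t / 2 * (\<delta> * exp (t * a)) \<le> ?L" using t by (intro mult_left_mono) auto
      moreover have "C * exp (t * a) < t / 2 * \<delta> * exp (t * a)"
        using t by (intro mult_strict_right_mono) auto
      ultimately show ?thesis unfolding mult.assoc by linarith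
    qed
    ultimately show ?case by linarith
  qed
qed

end

section \<open>Zeros of two real functions with a Wronskian of constant sign\<close>

text \<open>
  Otherwise \<open>f / g\<close> would be differentiable on \<open>[r, s]\<close> with equal end values, although the
  numerator of its derivative is the Wronskian and never vanishes.
\<close>
lemma Rolle_quotient:
  fixes f g f' g' :: "real \<Rightarrow> real"
  assumes f: "\<And>x. 0 < x \<Longrightarrow> (f has_real_derivative f' x) (at x)"
    and g: "\<And>x. 0 < x \<Longrightarrow> (g has_real_derivative g' x) (at x)"
    and W: "\<And>x. 0 < x \<Longrightarrow> g x * f' x - g' x * f x \<noteq> 0"
    and r: "0 < r" "r < s" "f r = 0" "f s = 0"
  shows "\<exists>t. r < t \<and> t < s \<and> g t = 0"
proof (rule ccontr)
  assume neg: "\<not> ?thesis"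
  have gnz: "g x \<noteq> 0" if "x \<in> {r..s}" for x
  proof (cases "x = r \<or> x = s")
    case True
    then show ?thesis using W[of x] r by auto
  next
    case False
    with that neg show ?thesis by fastforce
  qed
  have D: "((\<lambda>x. f x / g x) has_real_derivative (f' x * g x - f x * g' x) / (g x * g x)) (at x)"
    if "x \<in> {r..s}" for x
    using that r by (intro DERIV_divide f g gnz) auto
  have "\<exists>z. r < z \<and> z < s \<and> ((\<lambda>x. f x / g x) has_real_derivative 0) (at z)"
  proof (rule Rolle)
    show "continuous_on {r..s} (\<lambda>x. f x / g x)"
      using D by (meson DERIV_isCont continuous_at_imp_continuous_on)
    show "(\<lambda>x. f x / g x) differentiable (at x)" if "r < x" "x < s" for x
      using D[of x] that by (auto simp: real_differentiable_def)
  qed (use r in auto)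
  then obtain z where z: "r < z" "z < s" "((\<lambda>x. f x / g x) has_real_derivative 0) (at z)"
    by blast
  from DERIV_unique[OF z(3) D] z have "f' z * g z - f z * g' z = 0"
    using gnz[of z] by simp
  then show False using W[of z] z r by (simp add: algebra_simps)
qed

lemma interlace_of_wronskian:
  fixes f g f' g' :: "real \<Rightarrow> real"
  assumes f: "\<And>x. 0 < x \<Longrightarrow> (f has_real_derivative f' x) (at x)"
    and g: "\<And>x. 0 < x \<Longrightarrow> (g has_real_derivative g' x) (at x)"
    and W: "\<And>x. 0 < x \<Longrightarrow> g x * f' x - g' x * f x \<noteq> 0"
  shows "interlace {x. 0 < x \<and> g x = 0} {x. 0 < x \<and> f x = 0}"
proof -
  have W': "f x * g' x - f' x * g x \<noteq> 0" if "0 < x" for x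
    using W[OF that] by (simp add: algebra_simps)
  have "{x. 0 < x \<and> g x = 0} \<inter> {x. 0 < x \<and> f x = 0} = {}"
    using W by force
  moreover have "\<exists>t\<in>{x. 0 < x \<and> f x = 0}. r < t \<and> t < s" if "0 < r" "g r = 0" "g s = 0" "r < s" for r s
    using Rolle_quotient[OF g f W', of r s] that by (auto intro: less_trans)
  moreover have "\<exists>t\<in>{x. 0 < x \<and> g x = 0}. r < t \<and> t < s" if "0 < r" "f r = 0" "f s = 0" "r < s" for r s
    using Rolle_quotient[OF f g W, of r s] that by (auto intro: less_trans)
  ultimately show ?thesis
    unfolding interlace_def by simp
qed

lemma eventually_positive_after_last_zero:
  fixes f :: "real \<Rightarrow> real"
  assumes f: "continuous_on {r..} f" and nz: "\<And>x. r < x \<Longrightarrow> f x \<noteq> 0"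
    and pos: "eventually (\<lambda>x. 0 < f x) at_top" and x: "r < x"
  shows "0 < f x"
proof (rule ccontr)
  assume "\<not> 0 < f x"
  then have fx: "f x < 0" using nz[OF x] by linarith
  obtain N where N: "\<And>y. N \<le> y \<Longrightarrow> 0 < f y"
    using pos by (auto simp: eventually_at_top_linorder)
  define y where "y = max N (x + 1)"
  have "\<exists>t\<ge>x. t \<le> y \<and> f t = 0"
    using fx N[of y] x by (intro IVT') (auto simp: y_def intro: continuous_on_subset[OF f])
  then show False using nz x by fastforce
qed

text \<open>
  Downward induction on \<open>j\<close>. After the last zero \<open>f\<close> is positive, so it crosses upwards there; between
  consecutive zeros \<open>f\<close> keeps its sign, so the derivatives at them have opposite signs.
\<close>
lemma DERIV_alternating_signs:
  fixes f f' :: "real \<Rightarrow> real" and r :: "nat \<Rightarrow> real"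
  assumes f: "\<And>x. 0 < x \<Longrightarrow> (f has_real_derivative f' x) (at x)"
    and zeros: "{x. 0 < x \<and> f x = 0} = r ` {1..\<kappa>}"
    and incr: "\<And>j. j \<in> {1..<\<kappa>} \<Longrightarrow> r j < r (Suc j)"
    and simple: "\<And>j. j \<in> {1..\<kappa>} \<Longrightarrow> f' (r j) \<noteq> 0"
    and pos: "eventually (\<lambda>x. 0 < f x) at_top"
    and j: "j \<in> {1..\<kappa>}"
  shows "0 < f' (r j) * (- 1) ^ (\<kappa> - j)"
proof -
  have r: "0 < r i" "f (r i) = 0" if "i \<in> {1..\<kappa>}" for i
    using zeros that by blast+
  have mono: "r i < r k" if "1 \<le> i" "i < k" "k \<le> \<kappa>" for i k
    using that(2,1,3)
  proof (induction k rule: less_Suc_induct)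
    case (1 i) then show ?case using incr[of i] by auto
  next
    case (2 i j k) then show ?case by force
  qed
  have cont: "continuous_on S f" if "S \<subseteq> {0<..}" for S
    using that f by (meson DERIV_isCont continuous_at_imp_continuous_on greaterThan_iff subsetD)
  have "j \<le> \<kappa>" "1 \<le> j" using j by auto
  then show ?thesis
  proof (induction j rule: inc_induct)
    case base
    have nz: "f x \<noteq> 0" if x: "r \<kappa> < x" for x
    proof
      assume "f x = 0"
      then have "x \<in> {x. 0 < x \<and> f x = 0}" using x r(1)[of \<kappa>] base by auto
      then obtain i where i: "i \<in> {1..\<kappa>}" "x = r i" using zeros by auto
      then show False using x mono[of i \<kappa>] by (cases "i = \<kappa>") auto
    qed
    have pos': "0 < f x" if "r \<kappa> < x" for x
      using r(1)[of \<kappa>] base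
      by (intro eventually_positive_after_last_zero[OF cont nz pos that]) auto
    show ?case
    proof (rule ccontr)
      assume "\<not> ?case"
      then have "f' (r \<kappa>) < 0" using simple[of \<kappa>] base by auto
      from DERIV_neg_dec_right[OF f[OF r(1)] this] base
      obtain d where "d > 0" "\<And>h. 0 < h \<Longrightarrow> h < d \<Longrightarrow> f (r \<kappa> + h) < f (r \<kappa>)" by auto
      from this(2)[of "d / 2"] this(1) pos'[of "r \<kappa> + d / 2"] r(2)[of \<kappa>] base show False by auto
    qed
  next
    case (step j)
    have j: "j \<in> {1..\<kappa>}" "Suc j \<in> {1..\<kappa>}" using step.hyps step.prems by auto
    have lt: "r j < r (Suc j)" using incr[of j] step by auto
    have nz: "f x \<noteq> 0" if x: "r j < x" "x < r (Suc j)" for x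
    proof
      assume "f x = 0"
      then have "x \<in> {x. 0 < x \<and> f x = 0}" using x r(1)[OF j(1)] by auto
      then obtain i where i: "i \<in> {1..\<kappa>}" "x = r i" using zeros by auto
      then show False
        using x mono[of i j] mono[of "Suc j" i] j by (cases i j rule: linorder_cases; cases "i = Suc j") auto
    qed
    have opp: "f' (r j) * f' (r (Suc j)) < 0"
    proof (rule ccontr)
      assume "\<not> ?thesis"
      then have same: "0 < f' (r j) * f' (r (Suc j))"
        using simple[OF j(1)] simple[OF j(2)] by (simp add: not_less less_le)
      have between: "\<exists>x y. r j < x \<and> x < y \<and> y < r (Suc j) \<and> f x * f y < 0"
      proof -
        \<comment> \<open>multiplying \<open>f\<close> by a sign makes both derivatives positive\<close>
        obtain c :: real where c: "c * c = 1" "0 < c * f' (r j)" "0 < c * f' (r (Suc j))"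
        proof (cases "0 < f' (r j)")
          case True
          then show thesis using same that[of 1] by (simp add: zero_less_mult_iff)
        next
          case False
          then show thesis using same that[of "- 1"] by (simp add: zero_less_mult_iff)
        qed
        have D: "((\<lambda>x. c * f x) has_real_derivative c * f' x) (at x)" if "0 < x" for x
          using f[OF that] by (rule DERIV_cmult)
        obtain d1 where d1: "d1 > 0" "\<And>h. 0 < h \<Longrightarrow> h < d1 \<Longrightarrow> c * f (r j) < c * f (r j + h)"
          using DERIV_pos_inc_right[OF D[OF r(1)[OF j(1)]] c(2)] by auto
        obtain d2 where d2: "d2 > 0" "\<And>h. 0 < h \<Longrightarrow> h < d2 \<Longrightarrow> c * f (r (Suc j) - h) < c * f (r (Suc j))"
          using DERIV_pos_inc_left[OF D[OF r(1)[OF j(2)]] c(3)] by auto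
        define h where "h = min (min d1 d2) (r (Suc j) - r j) / 3"
        have "0 < h" "3 * h \<le> d1" "3 * h \<le> d2" "3 * h \<le> r (Suc j) - r j"
          using d1(1) d2(1) lt by (simp_all add: h_def)
        then have h: "0 < h" "h < d1" "h < d2" "r j + h < r (Suc j) - h"
          by linarith+
        have s: "0 < c * f (r j + h)" "c * f (r (Suc j) - h) < 0"
          using d1(2)[of h] d2(2)[of h] h r(2)[OF j(1)] r(2)[OF j(2)] by auto
        have "(c * f (r j + h)) * (c * f (r (Suc j) - h)) < 0"
          using s by (rule mult_pos_neg)
        then have "(c * c) * (f (r j + h) * f (r (Suc j) - h)) < 0" by (simp only: mult_ac)
        then show ?thesis
          using h c by (intro exI[of _ "r j + h"] exI[of _ "r (Suc j) - h"]) auto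
      qed
      then obtain x y where xy: "r j < x" "x < y" "y < r (Suc j)" "f x * f y < 0" by blast
      have "continuous_on {x..y} f" using xy r(1)[OF j(1)] by (intro cont) auto
      then have "\<exists>t\<ge>x. t \<le> y \<and> f t = 0"
        using xy IVT'[of f x 0 y] IVT2'[of f y 0 x] by (auto simp: mult_less_0_iff)
      then show False using nz xy by force
    qed
    define e :: real where "e = (- 1) ^ (\<kappa> - Suc j)"
    have "\<kappa> - j = Suc (\<kappa> - Suc j)" using step.hyps by simp
    then have pw: "(- 1) ^ (\<kappa> - j) = - e" by (simp add: e_def)
    have ee: "e * e = 1" by (simp add: e_def flip: power_mult_distrib)
    have "(f' (r j) * (- e)) * (f' (r (Suc j)) * e) = - (f' (r j) * f' (r (Suc j))) * (e * e)"
      by (simp add: algebra_simps)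
    then have "0 < (f' (r j) * (- e)) * (f' (r (Suc j)) * e)" using opp unfolding ee by linarith
    moreover have "0 < f' (r (Suc j)) * e" unfolding e_def using step.IH j by simp
    ultimately have "0 < f' (r j) * (- e)" by (rule zero_less_mult_pos2)
    then show ?case unfolding pw .
  qed
qed

section \<open>Real coefficients\<close>

text \<open>
  The chain rule along \<open>t \<mapsto> - i t\<close> multiplies the complex derivative \<open>D\<close> by \<open>- i\<close>; since the values
  are real, so is \<open>- i D\<close>, which is therefore \<open>Im D\<close>.
\<close>
lemma has_real_derivative_neg_imag_axis:
  fixes F :: "complex \<Rightarrow> complex"
  assumes F: "(F has_field_derivative D) (at (- \<i> * of_real \<tau>))"
    and real: "\<And>t. Im (F (- \<i> * of_real t)) = 0"
  shows "((\<lambda>t. Re (F (- \<i> * of_real t))) has_real_derivative Im D) (at \<tau>)" and "Re D = 0"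
proof -
  have "((\<lambda>w. F (- \<i> * w)) has_field_derivative D * (- \<i>)) (at (of_real \<tau>))"
    by (rule DERIV_chain2[where g = "\<lambda>w. - \<i> * w", OF F]) (auto intro!: derivative_eq_intros)
  then have v: "((\<lambda>t. F (- \<i> * of_real t)) has_vector_derivative D * (- \<i>)) (at \<tau>)"
    by (rule has_vector_derivative_real_field)
  from bounded_linear.has_vector_derivative[OF bounded_linear_Re v]
  show "((\<lambda>t. Re (F (- \<i> * of_real t))) has_real_derivative Im D) (at \<tau>)"
    by (simp add: has_real_derivative_iff_has_vector_derivative)
  from bounded_linear.has_vector_derivative[OF bounded_linear_Im v]
  have "((\<lambda>t. 0 :: real) has_real_derivative - Re D) (at \<tau>)"
    unfolding real by (simp add: has_real_derivative_iff_has_vector_derivative)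
  from DERIV_unique[OF this DERIV_const] show "Re D = 0" by simp
qed

text \<open>
  The potential is real only almost everywhere, as it is determined only up to null sets.
\<close>
locale real_sturm_liouville = sturm_liouville +
  assumes q_real: "AE x in lebesgue. x \<in> {0<..<a} \<longrightarrow> q x \<in> \<real>" and \<beta>\<^sub>0_real: "\<beta>\<^sub>0 \<in> \<real>"
begin

text \<open>
  The conjugate of \<open>Y z\<close> solves the initial value problem with parameter \<open>- cnj z\<close>:
  the equation contains only \<open>z\<^sup>2\<close>, and the coefficient \<open>i \<alpha>\<^sub>0 z\<close> is conjugated to
  \<open>i \<alpha>\<^sub>0 (- cnj z)\<close>.
\<close>
lemma Y_cnj:
  assumes x: "x \<in> {0..a}"
  shows "Y (- cnj z) x = cnj (Y z x)" "Y' (- cnj z) x = cnj (Y' z x)"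
proof -
  obtain N where N: "negligible N" "\<And>x. x \<notin> N \<Longrightarrow> x \<in> {0<..<a} \<Longrightarrow> q x \<in> \<real>"
    using q_real unfolding eventually_ae_filter_negligible by blast
  have "negligible (N \<union> {0, a})" using N(1) by (simp add: negligible_Un)
  moreover have "(q t - (- cnj z)\<^sup>2) * cnj (Y z t) + 0 = cnj ((q t - z\<^sup>2) * Y z t)"
    if "t \<in> {0..a} - (N \<union> {0, a})" for t
  proof -
    have "q t \<in> \<real>" using that by (intro N(2)) auto
    then have "cnj (q t) = q t" by (simp only: Reals_cnj_iff)
    then show ?thesis by simp
  qed
  ultimately have 1: "twice_primitive a (\<lambda>t. (q t - (- cnj z)\<^sup>2) * cnj (Y z t) + 0) (cnj 1)
      (cnj (\<i> * of_real \<alpha>\<^sub>0 * z + \<beta>\<^sub>0)) (\<lambda>x. cnj (Y z x)) (\<lambda>x. cnj (Y' z x))"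
    by (rule twice_primitive_spike[OF twice_primitive_cnj[OF Y_solves[of z]]])
  have d: "cnj (\<i> * of_real \<alpha>\<^sub>0 * z + \<beta>\<^sub>0) = \<i> * of_real \<alpha>\<^sub>0 * (- cnj z) + \<beta>\<^sub>0"
    using \<beta>\<^sub>0_real by (simp add: Reals_cnj_iff[THEN iffD1])
  have 2: "twice_primitive a (\<lambda>t. (q t - (- cnj z)\<^sup>2) * Y (- cnj z) t + 0) (cnj 1)
      (\<i> * of_real \<alpha>\<^sub>0 * (- cnj z) + \<beta>\<^sub>0) (Y (- cnj z)) (Y' (- cnj z))"
    using Y_solves[of "- cnj z"] by simp
  show "Y (- cnj z) x = cnj (Y z x)" "Y' (- cnj z) x = cnj (Y' z x)"
    using volterra_unique[OF potential_integrable 2 1[unfolded d] x] .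
qed

lemma Delta_cnj:
  assumes "\<beta> \<in> \<real>"
  shows "Delta a q \<alpha>\<^sub>0 \<beta>\<^sub>0 \<alpha> \<beta> (- cnj z) = cnj (Delta a q \<alpha>\<^sub>0 \<beta>\<^sub>0 \<alpha> \<beta> z)"
  using Reals_cnj_iff[THEN iffD1, OF assms] Y_cnj[of a z] a by (simp add: Delta_def)

lemma Y_real_on_axis: "x \<in> {0..a} \<Longrightarrow> Im (Y (- \<i> * of_real t) x) = 0"
  using Y_cnj(1)[of x "- \<i> * of_real t"] by (simp add: complex_eq_iff)

lemma Delta0_real_on_axis: "Im (Delta0 a q \<alpha>\<^sub>0 \<beta>\<^sub>0 (- \<i> * of_real t)) = 0"
  using Y_real_on_axis[of a t] a by (simp add: Delta0_def)

lemma Delta_real_on_axis: "\<beta> \<in> \<real> \<Longrightarrow> Im (Delta a q \<alpha>\<^sub>0 \<beta>\<^sub>0 \<alpha> \<beta> (- \<i> * of_real t)) = 0"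
  using Delta_cnj[of \<beta> \<alpha> "- \<i> * of_real t"] by (simp add: complex_eq_iff)

text \<open>
  Green's identity for \<open>Y z\<close> and its conjugate, after division by \<open>Re z\<close>, says that
  \<open>2 Im z \<integral>\<bar>Y\<bar>\<^sup>2 = \<alpha> \<bar>Y(a)\<bar>\<^sup>2 + \<alpha>\<^sub>0\<close>. For \<open>Im z \<le> 0\<close> this forces \<open>Y(a) = 0\<close>, and then the boundary
  condition gives \<open>Y'(a) = 0\<close> as well.
\<close>
lemma lower_eigenvalue_imaginary:
  assumes \<beta>: "\<beta> \<in> \<real>" and \<alpha>: "0 < \<alpha>" and \<alpha>\<^sub>0: "0 \<le> \<alpha>\<^sub>0"
    and ev: "Delta a q \<alpha>\<^sub>0 \<beta>\<^sub>0 \<alpha> \<beta> z = 0" and z: "Im z \<le> 0"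
  shows "Re z = 0"
proof (rule ccontr)
  assume nz: "Re z \<noteq> 0"
  let ?w = "- cnj z"
  define n where "n = integral {0..a} (\<lambda>t. (cmod (Y z t))\<^sup>2)"
  have sq_int: "(\<lambda>t. (cmod (Y z t))\<^sup>2) integrable_on {0..a}"
    by (intro integrable_continuous_real continuous_intros Y_continuous)
  have n: "n \<ge> 0"
    unfolding n_def by (intro Henstock_Kurzweil_Integration.integral_nonneg sq_int) auto
  have bc: "Y' w a = - (\<i> * of_real \<alpha> * w + \<beta>) * Y w a" if "Delta a q \<alpha>\<^sub>0 \<beta>\<^sub>0 \<alpha> \<beta> w = 0" for w
    using that unfolding Delta_def by (simp add: eq_neg_iff_add_eq_0 del: minus_add_distrib)
  have Ya: "Y' z a = - (\<i> * of_real \<alpha> * z + \<beta>) * Y z a"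
    "Y' ?w a = - (\<i> * of_real \<alpha> * ?w + \<beta>) * Y ?w a"
    using ev Delta_cnj[OF \<beta>, of \<alpha> z] by (simp_all only: bc complex_cnj_zero)
  have Yw: "Y ?w t = cnj (Y z t)" if "t \<in> {0..a}" for t using Y_cnj(1)[OF that] .
  have "integral {0..a} (\<lambda>t. Y ?w t * ((q t - z\<^sup>2) * Y z t) - ((q t - ?w\<^sup>2) * Y ?w t) * Y z t) =
     integral {0..a} (\<lambda>t. (?w\<^sup>2 - z\<^sup>2) * of_real ((cmod (Y z t))\<^sup>2))"
  proof (rule Henstock_Kurzweil_Integration.integral_cong)
    fix t assume t: "t \<in> {0..a}"
    show "Y ?w t * ((q t - z\<^sup>2) * Y z t) - ((q t - ?w\<^sup>2) * Y ?w t) * Y z t =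
        (?w\<^sup>2 - z\<^sup>2) * of_real ((cmod (Y z t))\<^sup>2)"
      unfolding complex_norm_square Yw[OF t] by (simp add: algebra_simps)
  qed
  also have "\<dots> = (?w\<^sup>2 - z\<^sup>2) * of_real n"
    using integral_linear[OF sq_int bounded_linear_of_real[where 'a = complex]]
    by (simp add: n_def o_def)
  finally have "(?w\<^sup>2 - z\<^sup>2) * of_real n =
      (Y ?w a * Y' z a - Y' ?w a * Y z a) - (\<i> * of_real \<alpha>\<^sub>0 * z - \<i> * of_real \<alpha>\<^sub>0 * ?w)"
    using green_identity[OF Y_solves[of z] Y_solves[of ?w], of a] a by simp
  also have "\<dots> = - (\<i> * of_real \<alpha> * (z - ?w)) * (Y z a * cnj (Y z a)) - \<i> * of_real \<alpha>\<^sub>0 * (z - ?w)"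
    unfolding Ya using Yw[of a] a by (simp add: algebra_simps)
  also have "Y z a * cnj (Y z a) = of_real ((cmod (Y z a))\<^sup>2)"
    by (simp only: complex_norm_square)
  finally have "Re z * (2 * Im z * n) = Re z * (\<alpha> * (cmod (Y z a))\<^sup>2 + \<alpha>\<^sub>0)"
    by (simp add: complex_eq_iff power2_eq_square algebra_simps)
  then have eq: "2 * Im z * n = \<alpha> * (cmod (Y z a))\<^sup>2 + \<alpha>\<^sub>0" using nz by simp
  moreover have "2 * Im z * n \<le> 0" using z n by (simp add: mult_le_0_iff)
  ultimately have "\<alpha> * (cmod (Y z a))\<^sup>2 \<le> 0" using \<alpha>\<^sub>0 by simp
  then have "Y z a = 0" using \<alpha> by (simp add: mult_le_0_iff)
  with Ya(1) solution_no_double_zero[of z] show False by simp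
qed

text \<open>
  At \<open>z = - i \<tau>\<close> the identity of \<open>Delta0_Delta_derivatives\<close> has the imaginary part
  \<open>\<alpha>\<^sub>0 + 2 \<tau> \<integral>Y\<^sup>2 + \<alpha> Y(a)\<^sup>2\<close> with real \<open>Y\<close>. For \<open>\<tau> > 0\<close> the integral makes it positive, because
  \<open>Y\<close> starts with the value \<open>1\<close>; for \<open>\<tau> = 0\<close> the last term does, because \<open>Y(a) \<noteq> 0\<close> at an
  eigenvalue. The derivatives along the axis are the imaginary parts of the complex ones.
\<close>
lemma axis_wronskian_pos:
  assumes \<alpha>: "0 < \<alpha>" and \<alpha>\<^sub>0: "0 \<le> \<alpha>\<^sub>0" and \<beta>: "\<beta> \<in> \<real>"
    and \<tau>: "0 < \<tau> \<or> \<tau> = 0 \<and> Delta a q \<alpha>\<^sub>0 \<beta>\<^sub>0 \<alpha> \<beta> (- \<i> * of_real \<tau>) = 0"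
  defines "z \<equiv> - \<i> * of_real \<tau>"
  shows "0 < Re (Delta0 a q \<alpha>\<^sub>0 \<beta>\<^sub>0 z) * Im (deriv (Delta a q \<alpha>\<^sub>0 \<beta>\<^sub>0 \<alpha> \<beta>) z) -
             Im (deriv (Delta0 a q \<alpha>\<^sub>0 \<beta>\<^sub>0) z) * Re (Delta a q \<alpha>\<^sub>0 \<beta>\<^sub>0 \<alpha> \<beta> z)"
proof -

  obtain D0 D where D: "(Delta0 a q \<alpha>\<^sub>0 \<beta>\<^sub>0 has_field_derivative D0) (at z)"
    "(Delta a q \<alpha>\<^sub>0 \<beta>\<^sub>0 \<alpha> \<beta> has_field_derivative D) (at z)"
    and id: "Delta0 a q \<alpha>\<^sub>0 \<beta>\<^sub>0 z * D - D0 * Delta a q \<alpha>\<^sub>0 \<beta>\<^sub>0 \<alpha> \<beta> z =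
       \<i> * of_real \<alpha>\<^sub>0 - 2 * z * integral {0..a} (\<lambda>t. (Y z t)\<^sup>2) + \<i> * of_real \<alpha> * (Delta0 a q \<alpha>\<^sub>0 \<beta>\<^sub>0 z)\<^sup>2"
    by (rule Delta0_Delta_derivatives)
  note D' = DERIV_imp_deriv[OF D(1)] DERIV_imp_deriv[OF D(2)]
  define n where "n = integral {0..a} (\<lambda>t. (Re (Y z t))\<^sup>2)"
  have "(\<lambda>t. (Y z t)\<^sup>2) integrable_on {0..a}"
    by (intro integrable_continuous_real continuous_intros Y_continuous)
  from integral_linear[OF this bounded_linear_Re]
  have "Re (integral {0..a} (\<lambda>t. (Y z t)\<^sup>2)) = integral {0..a} (\<lambda>t. Re ((Y z t)\<^sup>2))"
    by (simp add: o_def)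
  also have "\<dots> = n"
    unfolding n_def by (rule Henstock_Kurzweil_Integration.integral_cong)
      (use Y_real_on_axis[of _ \<tau>] in \<open>auto simp: z_def power2_eq_square\<close>)
  finally have n: "Re (integral {0..a} (\<lambda>t. (Y z t)\<^sup>2)) = n" .
  have cont: "continuous_on {0..a} (\<lambda>t. (Re (Y z t))\<^sup>2)"
    by (intro continuous_intros Y_continuous)
  have "n \<ge> 0"
    unfolding n_def by (intro Henstock_Kurzweil_Integration.integral_nonneg integrable_continuous_real cont) auto
  moreover have "n \<noteq> 0"
    using integral_eq_0_iff[OF cont a] a Y_at_0[of z] unfolding n_def by force
  ultimately have npos: "n > 0" by simp
  have im: "Im (Delta0 a q \<alpha>\<^sub>0 \<beta>\<^sub>0 z) = 0" "Im (Delta a q \<alpha>\<^sub>0 \<beta>\<^sub>0 \<alpha> \<beta> z) = 0"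
    using Delta0_real_on_axis[of \<tau>] Delta_real_on_axis[OF \<beta>, of \<alpha> \<tau>] by (simp_all add: z_def)
  have "Re (Delta0 a q \<alpha>\<^sub>0 \<beta>\<^sub>0 z) * Im D - Im D0 * Re (Delta a q \<alpha>\<^sub>0 \<beta>\<^sub>0 \<alpha> \<beta> z) =
      \<alpha>\<^sub>0 + 2 * \<tau> * n + \<alpha> * (Re (Delta0 a q \<alpha>\<^sub>0 \<beta>\<^sub>0 z))\<^sup>2"
    using arg_cong[OF id, of Im] im n by (simp add: z_def power2_eq_square)
  moreover have "0 < \<dots>"
    using \<tau>
  proof
    assume "0 < \<tau>"
    then show ?thesis using npos \<alpha> \<alpha>\<^sub>0 by (intro add_pos_nonneg add_nonneg_pos) auto
  next
    assume t: "\<tau> = 0 \<and> Delta a q \<alpha>\<^sub>0 \<beta>\<^sub>0 \<alpha> \<beta> (- \<i> * of_real \<tau>) = 0"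
    then have "Delta0 a q \<alpha>\<^sub>0 \<beta>\<^sub>0 z \<noteq> 0"
      using solution_no_double_zero[of z] by (auto simp: Delta_def Delta0_def z_def)
    then have "Re (Delta0 a q \<alpha>\<^sub>0 \<beta>\<^sub>0 z) \<noteq> 0" using im by (simp add: complex_eq_iff)
    then show ?thesis using t \<alpha> \<alpha>\<^sub>0 by (intro add_nonneg_pos) auto
  qed
  ultimately show ?thesis unfolding D' by simp
qed

lemma axis_derivatives:
  assumes \<beta>: "\<beta> \<in> \<real>"
  shows "((\<lambda>t. Re (Delta0 a q \<alpha>\<^sub>0 \<beta>\<^sub>0 (- \<i> * of_real t))) has_real_derivative
            Im (deriv (Delta0 a q \<alpha>\<^sub>0 \<beta>\<^sub>0) (- \<i> * of_real \<tau>))) (at \<tau>)"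
    and "((\<lambda>t. Re (Delta a q \<alpha>\<^sub>0 \<beta>\<^sub>0 \<alpha> \<beta> (- \<i> * of_real t))) has_real_derivative
            Im (deriv (Delta a q \<alpha>\<^sub>0 \<beta>\<^sub>0 \<alpha> \<beta>) (- \<i> * of_real \<tau>))) (at \<tau>)"
    and "Re (deriv (Delta a q \<alpha>\<^sub>0 \<beta>\<^sub>0 \<alpha> \<beta>) (- \<i> * of_real \<tau>)) = 0"
proof -
  obtain D0 D where D: "(Delta0 a q \<alpha>\<^sub>0 \<beta>\<^sub>0 has_field_derivative D0) (at (- \<i> * of_real \<tau>))"
    "(Delta a q \<alpha>\<^sub>0 \<beta>\<^sub>0 \<alpha> \<beta> has_field_derivative D) (at (- \<i> * of_real \<tau>))"
    by (rule Delta0_Delta_derivatives)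
  note D' = DERIV_imp_deriv[OF D(1)] DERIV_imp_deriv[OF D(2)]
  show "((\<lambda>t. Re (Delta0 a q \<alpha>\<^sub>0 \<beta>\<^sub>0 (- \<i> * of_real t))) has_real_derivative
            Im (deriv (Delta0 a q \<alpha>\<^sub>0 \<beta>\<^sub>0) (- \<i> * of_real \<tau>))) (at \<tau>)"
    unfolding D' using D(1) Delta0_real_on_axis by (rule has_real_derivative_neg_imag_axis)
  show "((\<lambda>t. Re (Delta a q \<alpha>\<^sub>0 \<beta>\<^sub>0 \<alpha> \<beta> (- \<i> * of_real t))) has_real_derivative
            Im (deriv (Delta a q \<alpha>\<^sub>0 \<beta>\<^sub>0 \<alpha> \<beta>) (- \<i> * of_real \<tau>))) (at \<tau>)"
    unfolding D' using D(2) Delta_real_on_axis[OF \<beta>] by (rule has_real_derivative_neg_imag_axis)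
  show "Re (deriv (Delta a q \<alpha>\<^sub>0 \<beta>\<^sub>0 \<alpha> \<beta>) (- \<i> * of_real \<tau>)) = 0"
    unfolding D' using D(2) Delta_real_on_axis[OF \<beta>] by (rule has_real_derivative_neg_imag_axis)
qed

lemma axis_eigenvalue_simple:
  assumes \<alpha>: "0 < \<alpha>" and \<alpha>\<^sub>0: "0 \<le> \<alpha>\<^sub>0" and \<beta>: "\<beta> \<in> \<real>"
    and z: "Re z = 0" "Im z \<le> 0" and ev: "eigenvalue a q \<alpha>\<^sub>0 \<beta>\<^sub>0 \<alpha> \<beta> z"
  shows "simple_eigenvalue a q \<alpha>\<^sub>0 \<beta>\<^sub>0 \<alpha> \<beta> z"
proof -
  define \<tau> where "\<tau> = - Im z"
  have z_eq: "- \<i> * of_real \<tau> = z" using z by (simp add: complex_eq_iff \<tau>_def)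
  have D0: "Delta a q \<alpha>\<^sub>0 \<beta>\<^sub>0 \<alpha> \<beta> z = 0" using ev by (simp add: eigenvalue_def)
  have "0 < \<tau> \<or> \<tau> = 0 \<and> Delta a q \<alpha>\<^sub>0 \<beta>\<^sub>0 \<alpha> \<beta> (- \<i> * of_real \<tau>) = 0"
    using z D0 unfolding z_eq by (auto simp: \<tau>_def)
  from axis_wronskian_pos[OF \<alpha> \<alpha>\<^sub>0 \<beta> this] D0
  have "deriv (Delta a q \<alpha>\<^sub>0 \<beta>\<^sub>0 \<alpha> \<beta>) z \<noteq> 0" unfolding z_eq by auto
  then have "zorder (Delta a q \<alpha>\<^sub>0 \<beta>\<^sub>0 \<alpha> \<beta>) z = 1"
    using D0 by (intro zorder_zero_eqI[OF Delta_entire]) auto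
  with ev show ?thesis by (simp add: simple_eigenvalue_def)
qed

text \<open>
  At a zero of \<open>\<Delta>\<^sub>+\<close> the Wronskian inequality reads \<open>\<Delta>\<^sub>0 \<Delta>\<^sub>+' > 0\<close>, the prime denoting the derivative
  in \<open>\<tau>\<close>. So both signs follow from the alternation of the signs of \<open>\<Delta>\<^sub>+'\<close>, where
  \<open>\<Delta>\<^sub>+'\<close> equals \<open>- i\<close> times the derivative in \<open>z\<close>.
\<close>
lemma axis_zero_signs:
  assumes \<alpha>: "0 < \<alpha>" and \<alpha>\<^sub>0: "0 \<le> \<alpha>\<^sub>0" and \<beta>: "\<beta> \<in> \<real>"
    and ev: "{z \<in> neg_imag_axis. eigenvalue a q \<alpha>\<^sub>0 \<beta>\<^sub>0 \<alpha> \<beta> z} = ev ` {1..\<kappa>}"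
    and incr: "\<forall>j\<in>{1..<\<kappa>}. cmod (ev j) < cmod (ev (j + 1))"
    and j: "j \<in> {1..\<kappa>}"
  shows "\<i> * deriv (Delta a q \<alpha>\<^sub>0 \<beta>\<^sub>0 \<alpha> \<beta>) (- \<i> * of_real (cmod (ev j))) * (- 1) ^ (\<kappa> - j) < 0"
    and "Delta0 a q \<alpha>\<^sub>0 \<beta>\<^sub>0 (- \<i> * of_real (cmod (ev j))) * (- 1) ^ (\<kappa> - j) > 0"
proof -
  define f where "f \<equiv> \<lambda>t. Re (Delta a q \<alpha>\<^sub>0 \<beta>\<^sub>0 \<alpha> \<beta> (- \<i> * of_real t))"
  define f' where "f' \<equiv> \<lambda>t. Im (deriv (Delta a q \<alpha>\<^sub>0 \<beta>\<^sub>0 \<alpha> \<beta>) (- \<i> * of_real t))"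
  define g where "g \<equiv> \<lambda>t. Re (Delta0 a q \<alpha>\<^sub>0 \<beta>\<^sub>0 (- \<i> * of_real t))"
  define r where "r \<equiv> \<lambda>j. cmod (ev j)"
  have f0: "f t = 0 \<longleftrightarrow> eigenvalue a q \<alpha>\<^sub>0 \<beta>\<^sub>0 \<alpha> \<beta> (- \<i> * of_real t)" for t
    using Delta_real_on_axis[OF \<beta>, of \<alpha> t] by (simp add: f_def eigenvalue_def complex_eq_iff)
  have df: "(f has_real_derivative f' t) (at t)" for t
    unfolding f_def f'_def by (rule axis_derivatives(2)[OF \<beta>])
  have axis: "- \<i> * of_real (cmod z) = z" if "z \<in> neg_imag_axis" for z
    using that by (auto simp: neg_imag_axis_def complex_eq_iff cmod_def)
  have zeros: "{t. 0 < t \<and> f t = 0} = r ` {1..\<kappa>}"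
  proof (intro equalityI subsetI)
    fix t assume t: "t \<in> {t. 0 < t \<and> f t = 0}"
    then have "- \<i> * of_real t \<in> ev ` {1..\<kappa>}"
      unfolding ev[symmetric] using f0[of t] by (simp add: neg_imag_axis_def)
    then obtain i where "i \<in> {1..\<kappa>}" "- \<i> * of_real t = ev i" by auto
    moreover from this(2)[symmetric] have "r i = t" using t by (simp add: r_def norm_mult)
    ultimately show "t \<in> r ` {1..\<kappa>}" by auto
  next
    fix t assume "t \<in> r ` {1..\<kappa>}"
    then obtain i where i: "i \<in> {1..\<kappa>}" "t = r i" by auto
    then have "ev i \<in> {z \<in> neg_imag_axis. eigenvalue a q \<alpha>\<^sub>0 \<beta>\<^sub>0 \<alpha> \<beta> z}" unfolding ev by auto
    then show "t \<in> {t. 0 < t \<and> f t = 0}"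
      using axis[of "ev i"] by (auto simp: f0 i r_def neg_imag_axis_def)
  qed
  have gf: "0 < g t * f' t" if "t \<in> r ` {1..\<kappa>}" for t
    using that axis_wronskian_pos[OF \<alpha> \<alpha>\<^sub>0 \<beta>, of t]
    unfolding zeros[symmetric] by (auto simp: f_def g_def f'_def)
  have sign: "0 < f' (r j) * (- 1) ^ (\<kappa> - j)"
  proof (rule DERIV_alternating_signs[OF df zeros _ _ _ j])
    show "r i < r (Suc i)" if "i \<in> {1..<\<kappa>}" for i using incr that by (simp add: r_def)
    show "f' (r i) \<noteq> 0" if "i \<in> {1..\<kappa>}" for i using gf[of "r i"] that by auto
    show "eventually (\<lambda>t. 0 < f t) at_top"
      unfolding f_def by (rule Delta_eventually_positive[OF \<alpha> \<alpha>\<^sub>0])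
  qed
  have "\<i> * deriv (Delta a q \<alpha>\<^sub>0 \<beta>\<^sub>0 \<alpha> \<beta>) (- \<i> * of_real (r j)) = of_real (- f' (r j))"
    using axis_derivatives(3)[OF \<beta>, of \<alpha> "r j"] by (simp add: f'_def complex_eq_iff)
  then have "\<i> * deriv (Delta a q \<alpha>\<^sub>0 \<beta>\<^sub>0 \<alpha> \<beta>) (- \<i> * of_real (r j)) * (- 1) ^ (\<kappa> - j) =
      of_real (- (f' (r j) * (- 1) ^ (\<kappa> - j)))"
    by simp
  with sign show "\<i> * deriv (Delta a q \<alpha>\<^sub>0 \<beta>\<^sub>0 \<alpha> \<beta>) (- \<i> * of_real (cmod (ev j))) * (- 1) ^ (\<kappa> - j) < 0"
    unfolding r_def less_complex_def by simp
  have "0 < (g (r j) * f' (r j)) * ((- 1) ^ (\<kappa> - j) * (- 1) ^ (\<kappa> - j))"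
    using gf[of "r j"] j by (simp flip: power_mult_distrib)
  also have "\<dots> = (g (r j) * (- 1) ^ (\<kappa> - j)) * (f' (r j) * (- 1) ^ (\<kappa> - j))"
    by (simp only: mult_ac)
  finally have "0 < g (r j) * (- 1) ^ (\<kappa> - j)"
    using sign by (simp add: zero_less_mult_iff)
  moreover have "Delta0 a q \<alpha>\<^sub>0 \<beta>\<^sub>0 (- \<i> * of_real (r j)) = of_real (g (r j))"
    using Delta0_real_on_axis[of "r j"] by (simp add: g_def complex_eq_iff)
  then have "Delta0 a q \<alpha>\<^sub>0 \<beta>\<^sub>0 (- \<i> * of_real (r j)) * (- 1) ^ (\<kappa> - j) =
      of_real (g (r j) * (- 1) ^ (\<kappa> - j))"
    by simp
  ultimately show "Delta0 a q \<alpha>\<^sub>0 \<beta>\<^sub>0 (- \<i> * of_real (cmod (ev j))) * (- 1) ^ (\<kappa> - j) > 0"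
    unfolding r_def less_complex_def by simp
qed

lemma axis_zeros_interlace:
  assumes \<alpha>: "0 < \<alpha>" and \<alpha>\<^sub>0: "0 \<le> \<alpha>\<^sub>0" and \<beta>: "\<beta> \<in> \<real>"
  shows "interlace {r. 0 < r \<and> Delta0 a q \<alpha>\<^sub>0 \<beta>\<^sub>0 (- \<i> * of_real r) = 0}
                   {r. 0 < r \<and> Delta a q \<alpha>\<^sub>0 \<beta>\<^sub>0 \<alpha> \<beta> (- \<i> * of_real r) = 0}"
proof -
  have "Delta0 a q \<alpha>\<^sub>0 \<beta>\<^sub>0 (- \<i> * of_real r) = 0 \<longleftrightarrow> Re (Delta0 a q \<alpha>\<^sub>0 \<beta>\<^sub>0 (- \<i> * of_real r)) = 0"
    "Delta a q \<alpha>\<^sub>0 \<beta>\<^sub>0 \<alpha> \<beta> (- \<i> * of_real r) = 0 \<longleftrightarrow> Re (Delta a q \<alpha>\<^sub>0 \<beta>\<^sub>0 \<alpha> \<beta> (- \<i> * of_real r)) = 0" for r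
    using Delta0_real_on_axis[of r] Delta_real_on_axis[OF \<beta>, of \<alpha> r] by (simp_all add: complex_eq_iff)
  then show ?thesis
    using interlace_of_wronskian[OF axis_derivatives(2,1)[OF \<beta>]] axis_wronskian_pos[OF \<alpha> \<alpha>\<^sub>0 \<beta>]
    by (simp add: less_imp_neq[symmetric] del: right_minus_eq)
qed

end

theorem theorem2:
  fixes a \<alpha>\<^sub>0 \<alpha> :: real and \<beta>\<^sub>0 \<beta> :: complex and q :: "real \<Rightarrow> complex"
  assumes "a > 0" and "square_integrable a q" and "\<alpha>\<^sub>0 \<ge> 0" and "\<alpha> > 0"
  shows
    "finite {z. eigenvalue a q \<alpha>\<^sub>0 \<beta>\<^sub>0 \<alpha> \<beta> z \<and> Im z \<le> 0} \<and>
     ((\<alpha>\<^sub>0 - 1) * (1 - \<alpha>) \<noteq> 0 \<and> (\<alpha>\<^sub>0 + 1) * \<bar>\<alpha> - 1\<bar> > (\<alpha> + 1) * \<bar>\<alpha>\<^sub>0 - 1\<bar> \<longrightarrow>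
        finite {z. eigenvalue a q \<alpha>\<^sub>0 \<beta>\<^sub>0 (- \<alpha>) \<beta> z \<and> Im z \<le> 0}) \<and>
     ((\<alpha>\<^sub>0 - 1) * (1 - \<alpha>) \<noteq> 0 \<and> (\<alpha>\<^sub>0 + 1) * \<bar>\<alpha> - 1\<bar> < (\<alpha> + 1) * \<bar>\<alpha>\<^sub>0 - 1\<bar> \<longrightarrow>
        finite {z. eigenvalue a q \<alpha>\<^sub>0 \<beta>\<^sub>0 (- \<alpha>) \<beta> z \<and> Im z \<ge> 0}) \<and>
     ((AE x in lebesgue. x \<in> {0<..<a} \<longrightarrow> q x \<in> \<real>) \<and> \<beta> \<in> \<real> \<and> \<beta>\<^sub>0 \<in> \<real> \<longrightarrow>
       (eigenvalue a q \<alpha>\<^sub>0 \<beta>\<^sub>0 \<alpha> \<beta> 0 \<longrightarrow> simple_eigenvalue a q \<alpha>\<^sub>0 \<beta>\<^sub>0 \<alpha> \<beta> 0) \<and>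
       (\<forall>\<alpha>'\<in>{\<alpha>, - \<alpha>}. \<forall>z. eigenvalue a q \<alpha>\<^sub>0 \<beta>\<^sub>0 \<alpha>' \<beta> z \<longrightarrow> eigenvalue a q \<alpha>\<^sub>0 \<beta>\<^sub>0 \<alpha>' \<beta> (- cnj z)) \<and>
       (\<forall>z. eigenvalue a q \<alpha>\<^sub>0 \<beta>\<^sub>0 \<alpha> \<beta> z \<and> z \<noteq> 0 \<and> Im z \<le> 0 \<longrightarrow>
          z \<in> neg_imag_axis \<and> simple_eigenvalue a q \<alpha>\<^sub>0 \<beta>\<^sub>0 \<alpha> \<beta> z) \<and>
       (\<forall>(\<kappa>::nat) (ev::nat \<Rightarrow> complex).
          {z \<in> neg_imag_axis. eigenvalue a q \<alpha>\<^sub>0 \<beta>\<^sub>0 \<alpha> \<beta> z} = ev ` {1..\<kappa>} \<and>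
          (\<forall>j\<in>{1..<\<kappa>}. cmod (ev j) < cmod (ev (j + 1))) \<longrightarrow>
            (\<forall>j\<in>{1..\<kappa>}.
               \<i> * deriv (Delta a q \<alpha>\<^sub>0 \<beta>\<^sub>0 \<alpha> \<beta>) (- \<i> * of_real (cmod (ev j))) * (- 1) ^ (\<kappa> - j) < 0 \<and>
               Delta0 a q \<alpha>\<^sub>0 \<beta>\<^sub>0 (- \<i> * of_real (cmod (ev j))) * (- 1) ^ (\<kappa> - j) > 0) \<and>
            interlace {r. 0 < r \<and> Delta0 a q \<alpha>\<^sub>0 \<beta>\<^sub>0 (- \<i> * of_real r) = 0}
                      {r. 0 < r \<and> Delta a q \<alpha>\<^sub>0 \<beta>\<^sub>0 \<alpha> \<beta> (- \<i> * of_real r) = 0}))"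
proof -
  note \<alpha>\<^sub>0 = assms(3) and \<alpha> = assms(4)
  interpret sturm_liouville a q \<alpha>\<^sub>0 \<beta>\<^sub>0
    using assms(1) square_integrable_imp_absolutely_integrable[OF assms(2)] by unfold_locales
  have fin: "finite {z. eigenvalue a q \<alpha>\<^sub>0 \<beta>\<^sub>0 \<alpha> \<beta> z \<and> Im z \<le> 0}"
    using finite_eigenvalues_half_plane[of "{z. Im z \<le> 0}" \<alpha> \<beta>] abs_reflection_less[OF \<alpha> \<alpha>\<^sub>0] by simp
  have coeff: "\<bar>(1 + - \<alpha>) * (1 + \<alpha>\<^sub>0)\<bar> = (\<alpha>\<^sub>0 + 1) * \<bar>\<alpha> - 1\<bar>" "\<bar>(1 - - \<alpha>) * (1 - \<alpha>\<^sub>0)\<bar> = (\<alpha> + 1) * \<bar>\<alpha>\<^sub>0 - 1\<bar>"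
    using \<alpha> \<alpha>\<^sub>0 by (simp_all add: abs_mult abs_minus_commute mult.commute add.commute)
  have fin_minus: "(\<alpha>\<^sub>0 + 1) * \<bar>\<alpha> - 1\<bar> > (\<alpha> + 1) * \<bar>\<alpha>\<^sub>0 - 1\<bar> \<Longrightarrow>
        finite {z. eigenvalue a q \<alpha>\<^sub>0 \<beta>\<^sub>0 (- \<alpha>) \<beta> z \<and> Im z \<le> 0}"
    "(\<alpha>\<^sub>0 + 1) * \<bar>\<alpha> - 1\<bar> < (\<alpha> + 1) * \<bar>\<alpha>\<^sub>0 - 1\<bar> \<Longrightarrow>
        finite {z. eigenvalue a q \<alpha>\<^sub>0 \<beta>\<^sub>0 (- \<alpha>) \<beta> z \<and> Im z \<ge> 0}"
    using finite_eigenvalues_half_plane[of "{z. Im z \<le> 0}" "- \<alpha>" \<beta>, unfolded coeff]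
      finite_eigenvalues_half_plane[of "{z. 0 \<le> Im z}" "- \<alpha>" \<beta>, unfolded coeff] by simp_all
  have real: "real_sturm_liouville a q \<beta>\<^sub>0"
    if "(AE x in lebesgue. x \<in> {0<..<a} \<longrightarrow> q x \<in> \<real>) \<and> \<beta> \<in> \<real> \<and> \<beta>\<^sub>0 \<in> \<real>"
    using that by unfold_locales auto
  note simple = real_sturm_liouville.axis_eigenvalue_simple[OF real \<alpha> \<alpha>\<^sub>0]
    and imaginary = real_sturm_liouville.lower_eigenvalue_imaginary[OF real _ \<alpha> \<alpha>\<^sub>0]
    and symmetric = real_sturm_liouville.Delta_cnj[OF real]
    and signs = real_sturm_liouville.axis_zero_signs[OF real \<alpha> \<alpha>\<^sub>0]
    and interlacing = real_sturm_liouville.axis_zeros_interlace[OF real \<alpha> \<alpha>\<^sub>0]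
  show ?thesis
  proof (intro conjI impI allI ballI, goal_cases)
    case 1
    show ?case by (rule fin)
  next
    case 2
    then show ?case using fin_minus(1) by blast
  next
    case 3
    then show ?case using fin_minus(2) by blast
  next
    case 4
    show ?case by (rule simple) (use 4 in simp_all)
  next
    case (5 \<alpha>' z)
    then have "Delta a q \<alpha>\<^sub>0 \<beta>\<^sub>0 \<alpha>' \<beta> (- cnj z) = cnj (Delta a q \<alpha>\<^sub>0 \<beta>\<^sub>0 \<alpha>' \<beta> z)"
      by (intro symmetric) auto
    with 5 show ?case by (simp add: eigenvalue_def)
  next
    case (6 z)
    have "Re z = 0" by (rule imaginary[where \<beta> = \<beta>]) (use 6 in \<open>simp_all add: eigenvalue_def\<close>)
    with 6 show ?case by (auto simp: neg_imag_axis_def complex_eq_iff)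
  next
    case (7 z)
    have "Re z = 0" by (rule imaginary[where \<beta> = \<beta>]) (use 7 in \<open>simp_all add: eigenvalue_def\<close>)
    then show ?case by (intro simple) (use 7 in simp_all)
  next
    case (8 \<kappa> ev j)
    show ?case by (rule signs(1)) (use 8 in blast)+
  next
    case (9 \<kappa> ev j)
    show ?case by (rule signs(2)) (use 9 in blast)+
  next
    case (10 \<kappa> ev)
    then show ?case using interlacing by blast
  qed
qed

end
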